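(* Let $\alpha\in\mathbb{R}_{>0}$ be an algebraic number. If the additive monoid $\mathbb{N}_0[\alpha]$ is finitely generated, then $\alpha$ is a weak Perron number. Conversely, suppose that $\alpha$ is an algebraic integer, that $\alpha$ is a weak Perron number, and that $\alpha$ is the unique positive conjugate of its minimal polynomial (that is, $\alpha$ is the only positive real root of its minimal polynomial over $\mathbb{Q}$). Then $\mathbb{N}_0[\alpha]$ is finitely generated.
   Context: $\mathbb{N}_0=\{0,1,2,\dots\}$. For $\alpha\in\mathbb{R}_{>0}$, $\mathbb{N}_0[\alpha]=\{f(\alpha): f(X)\in\mathbb{N}_0[X]\}\subseteq\mathbb{R}_{\ge 0}$, viewed as a commutative monoid under addition. A commutative monoid $(M,+,0)$ is finitely generated if there is a finite subset $S\subseteq M$ such that every element of $M$ is a finite (possibly empty) sum of elements of $S$. A real algebraic number $\alpha$ is a weak Perron number if $\alpha>0$ and $|\beta|\le\alpha$ for every Galois conjugate $\beta\in\mathbb{C}$ of $\alpha$ over $\mathbb{Q}$. *)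

theory Defs
  imports Complex_Main "HOL-Computational_Algebra.Computational_Algebra"
begin

text \<open>The set \<open>\<nat>\<^sub>0[\<alpha>]\<close>; its additive structure is inherited from \<^typ>\<open>real\<close>.\<close>

definition nat_poly_monoid :: "real \<Rightarrow> real set" where
  "nat_poly_monoid \<alpha> = {poly (map_poly real f) \<alpha> | f :: nat poly. True}"

text \<open>
  The set \<open>M\<close> is intended to be (the carrier of) a submonoid of the ambient type.
  The empty list contributes the empty sum \<open>0\<close>, and repetitions of generators are allowed.
\<close>

definition fin_gen_monoid :: "'a::comm_monoid_add set \<Rightarrow> bool" where
  "fin_gen_monoid M \<longleftrightarrow>
     (\<exists>S. finite S \<and> S \<subseteq> M \<and> (\<forall>x\<in>M. \<exists>xs. set xs \<subseteq> S \<and> x = sum_list xs))"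

text \<open>
  The minimal polynomial over the rationals. For a transcendental \<open>x\<close> the value is
  unspecified; see \<open>min_poly_unique_exists\<close> for the algebraic case.
\<close>

definition is_min_poly :: "'a::field_char_0 \<Rightarrow> rat poly \<Rightarrow> bool" where
  "is_min_poly x p \<longleftrightarrow> lead_coeff p = 1 \<and> irreducible p \<and> poly (map_poly of_rat p) x = 0"

definition min_poly :: "'a::field_char_0 \<Rightarrow> rat poly" where
  "min_poly x = (THE p. is_min_poly x p)"

text \<open>
  The conjugates may live in a different field from \<open>\<alpha>\<close>, e.g. complex conjugates
  of a real number.
\<close>

definition galois_conjugate :: "'b::field_char_0 \<Rightarrow> 'a::field_char_0 \<Rightarrow> bool" where
  "galois_conjugate \<beta> \<alpha> \<longleftrightarrow> poly (map_poly of_rat (min_poly \<alpha>)) \<beta> = 0"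

definition weak_perron :: "real \<Rightarrow> bool" where
  "weak_perron \<alpha> \<longleftrightarrow>
     algebraic \<alpha> \<and> \<alpha> > 0 \<and> (\<forall>\<beta>::complex. galois_conjugate \<beta> \<alpha> \<longrightarrow> norm \<beta> \<le> \<alpha>)"

lemma map_poly_of_rat_mult:
  "map_poly (of_rat :: rat \<Rightarrow> 'a::field_char_0) (p * q) = map_poly of_rat p * map_poly of_rat q"
  by (rule poly_eqI) (simp add: coeff_map_poly coeff_mult of_rat_sum of_rat_mult)

lemma map_poly_of_rat_add:
  "map_poly (of_rat :: rat \<Rightarrow> 'a::field_char_0) (p + q) = map_poly of_rat p + map_poly of_rat q"
  by (rule poly_eqI) (simp add: coeff_map_poly of_rat_add)

lemma min_poly_unique_exists:
  fixes x :: "'a::field_char_0"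
  assumes "algebraic x"
  shows "\<exists>!p. is_min_poly x p"
proof -
  let ?ev = "\<lambda>p::rat poly. poly (map_poly of_rat p) x"
  let ?P = "\<lambda>p::rat poly. p \<noteq> 0 \<and> ?ev p = 0"
  obtain r where r: "\<And>i. coeff r i \<in> \<rat>" "r \<noteq> 0" "poly r x = 0"
    using assms unfolding algebraic_altdef by blast
  obtain r' where "r = map_poly of_rat r'"
    using r(1) by (rule ratpolyE[of r]) blast
  with r have "?P r'" by auto
  then obtain q where q: "?P q" and qmin: "\<And>s. ?P s \<Longrightarrow> degree q \<le> degree s"
    using ex_has_least_nat[of ?P r' degree] by blast
  define p where "p = smult (inverse (lead_coeff q)) q"
  have c: "inverse (lead_coeff q) \<noteq> 0" using q by simp
  have p0: "p \<noteq> 0" and pdeg: "degree p = degree q" and plc: "lead_coeff p = 1"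
    using q by (simp_all add: p_def)
  have "p = [:inverse (lead_coeff q):] * q" by (simp add: p_def)
  then have pev: "?ev p = 0" using q by (simp only: map_poly_of_rat_mult poly_mult) simp
  have pmin: "degree p \<le> degree s" if "s \<noteq> 0" "?ev s = 0" for s
    using qmin[of s] that pdeg by simp
  have pdegpos: "degree p \<noteq> 0"
  proof
    assume "degree p = 0"
    with plc have "p = 1" by (metis degree_eq_zeroE lead_coeff_pCons(2) one_pCons)
    with pev show False by simp
  qed
  have irr: "irreducible p"
  proof (rule irreducibleI)
    show "p \<noteq> 0" by (fact p0)
    show "\<not> p dvd 1" using pdegpos by (simp add: is_unit_iff_degree[OF p0])
    fix a b assume ab: "p = a * b"
    with p0 have ab0: "a \<noteq> 0" "b \<noteq> 0" by auto
    have deg: "degree p = degree a + degree b" using ab ab0 by (simp add: degree_mult_eq)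
    have "?ev a = 0 \<or> ?ev b = 0" using pev ab by (simp add: map_poly_of_rat_mult)
    then show "a dvd 1 \<or> b dvd 1"
      using pmin[of a] pmin[of b] ab0 deg
      by (auto simp: is_unit_iff_degree)
  qed
  have uniq: "s = p" if s: "is_min_poly x s" for s
  proof -
    have s': "lead_coeff s = 1" "irreducible s" "?ev s = 0"
      using s by (auto simp: is_min_poly_def)
    have "?ev s = ?ev (s div p * p + s mod p)" by simp
    also have "\<dots> = ?ev (s mod p)"
      by (simp only: map_poly_of_rat_add map_poly_of_rat_mult poly_add poly_mult pev) simp
    finally have m: "?ev (s mod p) = 0" using s' by simp
    have "s mod p = 0"
    proof (rule ccontr)
      assume "s mod p \<noteq> 0"
      with pmin[OF this m] degree_mod_less[OF p0, of s] show False by simp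
    qed
    then obtain t where t: "s = p * t" by blast
    with s'(2) have "p dvd 1 \<or> t dvd 1" by (auto dest: irreducibleD)
    moreover have "\<not> p dvd 1" using irr by (rule irreducible_not_unit)
    ultimately obtain d where d: "t = [:d:]" by (auto simp: is_unit_poly_iff)
    have "lead_coeff s = d" using t d plc by (simp add: lead_coeff_mult)
    with s'(1) t d show "s = p" by simp
  qed
  show ?thesis
  proof (rule ex1I)
    show "is_min_poly x p" using plc irr pev by (simp add: is_min_poly_def)
  qed (fact uniq)
qed

lemma is_min_poly_min_poly: "algebraic x \<Longrightarrow> is_min_poly x (min_poly x)"
  unfolding min_poly_def by (rule theI') (rule min_poly_unique_exists)

end

theory Submission
  imports Defs
begin

text \<open>
  \<open>\<nat>\<^sub>0[\<alpha>]\<close> is finitely generated iff \<open>\<alpha>\<^sup>N = f(\<alpha>)\<close> for some \<open>f\<close> with coefficients in \<open>\<nat>\<^sub>0\<close>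
  and degree below \<open>N\<close>. Since \<open>f(t) / t\<^sup>N\<close> decreases, every root of \<open>X\<^sup>N - f\<close> then has modulus
  at most \<open>\<alpha>\<close>.

  Conversely, counting products \<open>x y = \<beta>\<^sup>2\<close> of conjugates, for \<open>\<beta>\<close> a conjugate of maximal
  modulus, shows that the conjugates of maximal modulus are exactly the \<open>k\<close>-th roots of
  \<open>\<alpha>\<^sup>k\<close> for some \<open>k\<close>, and that the minimal polynomial is \<open>g(X\<^sup>k)\<close>, where
  \<open>A = \<alpha>\<^sup>k\<close> strictly dominates the other roots of \<open>g\<close> and is its only root in \<open>[0, \<infinity>)\<close>. Then there
  is a real polynomial \<open>E\<close> with positive coefficients, \<open>E(A) = 1\<close>, vanishing at the other roots.
  With \<open>E = g w + L\<close>, the integer polynomial \<open>(X\<^sup>n mod g) + g \<lfloor>A\<^sup>n w\<rfloor>\<close> takes the value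
  \<open>A\<^sup>n\<close> at \<open>A\<close> and has coefficients asymptotic to those of \<open>A\<^sup>n E\<close>, so they are
  eventually positive.
\<close>

section \<open>Power relations and finite generation\<close>

text \<open>The powers of \<alpha> below \<open>N\<close> generate: \<open>rel\<close> replaces
  \<alpha>^N by lower powers with natural coefficients, so their span contains every further
  power.\<close>

lemma fin_gen_of_power_relation:
  fixes \<alpha> :: real and f :: "nat poly"
  assumes rel: "\<alpha> ^ N = poly (map_poly real f) \<alpha>" and deg: "degree f < N"
  shows "fin_gen_monoid (nat_poly_monoid \<alpha>)"
proof -
  define S where "S = (\<lambda>i. \<alpha> ^ i) ` {..<N}"
  define T where "T = {sum_list xs | xs. set xs \<subseteq> S}"
  have T0: "0 \<in> T" unfolding T_def by (auto intro!: exI[of _ "[]"])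
  have Tadd: "x + y \<in> T" if "x \<in> T" "y \<in> T" for x y
  proof -
    from that obtain xs ys where "set xs \<subseteq> S" "x = sum_list xs" "set ys \<subseteq> S" "y = sum_list ys"
      unfolding T_def by auto
    then show ?thesis unfolding T_def by (auto intro!: exI[of _ "xs @ ys"])
  qed
  have TS: "x \<in> T" if "x \<in> S" for x
    using that unfolding T_def by (auto intro!: exI[of _ "[x]"])
  have Tmul: "real n * x \<in> T" if "x \<in> T" for n x
    by (induction n) (auto simp: algebra_simps T0 intro: Tadd that)
  have Tsum: "sum g A \<in> T" if "\<And>i. i \<in> A \<Longrightarrow> g i \<in> T" for g and A :: "nat set"
    using that by (induction A rule: infinite_finite_induct) (auto intro: T0 Tadd)
  have Tpoly: "poly (map_poly real q) \<alpha> \<in> T" if "\<And>i. i \<le> degree q \<Longrightarrow> \<alpha> ^ i \<in> T" for q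
    unfolding poly_altdef by (auto intro!: Tsum Tmul that simp: coeff_map_poly dest: order_trans[OF _ map_poly_degree_leq])
  have "\<alpha> ^ N \<in> T"
    unfolding rel using deg by (intro Tpoly TS) (auto simp: S_def)
  \<comment> \<open>Multiplication by \<alpha> moves each generator to the next one; only the last
    can leave \<open>S\<close>, and \<open>rel\<close> brings it back into \<open>T\<close>.\<close>
  have shift: "\<alpha> * sum_list xs \<in> T" if "set xs \<subseteq> S" for xs
    using that
  proof (induction xs)
    case (Cons x xs)
    then obtain i where i: "i < N" "x = \<alpha> ^ i" by (auto simp: S_def)
    have "\<alpha> ^ Suc i \<in> T"
      using i \<open>\<alpha> ^ N \<in> T\<close> TS[of "\<alpha> ^ Suc i"]
      by (cases "Suc i = N") (auto simp: S_def simp del: power_Suc)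
    then show ?case using Cons i by (auto simp: algebra_simps intro: Tadd)
  qed (auto simp: T0)
  have pow: "\<alpha> ^ n \<in> T" for n
  proof (induction n)
    case 0
    then show ?case using deg by (intro TS) (auto simp: S_def intro!: image_eqI[of _ _ 0])
  next
    case (Suc n)
    then show ?case using shift by (auto simp: T_def)
  qed
  have "S \<subseteq> nat_poly_monoid \<alpha>"
  proof
    fix x assume "x \<in> S"
    then obtain i where "x = \<alpha> ^ i" by (auto simp: S_def)
    then have "x = poly (map_poly real (monom 1 i)) \<alpha>"
      by (simp add: map_poly_monom poly_monom)
    then show "x \<in> nat_poly_monoid \<alpha>" unfolding nat_poly_monoid_def by blast
  qed
  moreover have "finite S" by (simp add: S_def)
  moreover have "\<forall>x\<in>nat_poly_monoid \<alpha>. \<exists>xs. set xs \<subseteq> S \<and> x = sum_list xs"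
    using Tpoly[OF pow] unfolding nat_poly_monoid_def T_def by blast
  ultimately show ?thesis unfolding fin_gen_monoid_def by blast
qed

text \<open>Finitely many generators involve only finitely many powers of \<alpha>; a power beyond
  all of them is still a sum of generators.\<close>

lemma power_relation_of_fin_gen:
  fixes \<alpha> :: real
  assumes "fin_gen_monoid (nat_poly_monoid \<alpha>)"
  obtains N and f :: "nat poly" where "\<alpha> ^ N = poly (map_poly real f) \<alpha>" "degree f < N"
proof -
  obtain S where S: "finite S" "S \<subseteq> nat_poly_monoid \<alpha>"
      "\<forall>x\<in>nat_poly_monoid \<alpha>. \<exists>xs. set xs \<subseteq> S \<and> x = sum_list xs"
    using assms unfolding fin_gen_monoid_def by blast
  have "\<forall>s\<in>S. \<exists>f :: nat poly. s = poly (map_poly real f) \<alpha>"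
    using S(2) unfolding nat_poly_monoid_def by auto
  then obtain F where F: "\<And>s. s \<in> S \<Longrightarrow> s = poly (map_poly real (F s)) \<alpha>" by metis
  \<comment> \<open>The sum bounds every single degree, and \<open>Suc\<close> makes the bound
    strict and keeps \<open>N\<close> positive when \<open>S\<close> is empty.\<close>
  define N where "N = Suc (\<Sum>s\<in>S. degree (F s))"
  have FN: "degree (F s) < N" if "s \<in> S" for s
    using member_le_sum[of s S "\<lambda>s. degree (F s)"] that S(1) by (simp add: N_def)
  have *: "\<exists>f :: nat poly. degree f < N \<and> sum_list xs = poly (map_poly real f) \<alpha>" if "set xs \<subseteq> S" for xs
    using that
  proof (induction xs)
    case Nil
    then show ?case by (auto intro!: exI[of _ 0] simp: N_def)
  next
    case (Cons x xs)
    then obtain f where f: "degree f < N" "sum_list xs = poly (map_poly real f) \<alpha>" by auto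
    have "map_poly real (F x + f) = map_poly real (F x) + map_poly real f"
      by (rule poly_eqI) (simp add: coeff_map_poly)
    with f Cons.prems F[of x] FN[of x] show ?case
      by (intro exI[of _ "F x + f"]) (auto intro: degree_add_less)
  qed
  have "\<alpha> ^ N = poly (map_poly real (monom 1 N)) \<alpha>"
    by (simp add: map_poly_monom poly_monom)
  then have "\<alpha> ^ N \<in> nat_poly_monoid \<alpha>" unfolding nat_poly_monoid_def by blast
  with S(3) * obtain f :: "nat poly" where "degree f < N" "\<alpha> ^ N = poly (map_poly real f) \<alpha>"
    by metis
  with that show ?thesis by blast
qed

lemma norm_root_le_of_power_relation:
  fixes \<alpha> :: real and f :: "nat poly" and z :: complex
  assumes "\<alpha> > 0" and rel: "\<alpha> ^ N = poly (map_poly real f) \<alpha>" and deg: "degree f < N"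
    and z: "z ^ N = poly (map_poly of_nat f) z"
  shows "norm z \<le> \<alpha>"
proof (rule ccontr)
  define t where "t = norm z / \<alpha>"
  assume "\<not> norm z \<le> \<alpha>"
  then have t: "t > 1" "norm z = t * \<alpha>" using \<open>\<alpha> > 0\<close> by (auto simp: t_def field_simps)
  have "norm z ^ N \<le> (\<Sum>i\<le>degree f. real (coeff f i) * norm z ^ i)"
  proof -
    have "norm z ^ N = norm (poly (map_poly of_nat f) z)" using z by (metis norm_power)
    also have "\<dots> = norm (\<Sum>i\<le>degree f. of_nat (coeff f i) * z ^ i)"
      by (simp add: poly_altdef coeff_map_poly degree_map_poly)
    also have "\<dots> \<le> (\<Sum>i\<le>degree f. norm (of_nat (coeff f i) * z ^ i))" by (rule norm_sum)
    finally show ?thesis by (simp add: norm_mult norm_power)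
  qed
  \<comment> \<open>All exponents are at most \<open>N - 1\<close>, so enlarging the argument by
    \<open>t > 1\<close> costs at most \<open>t ^ (N - 1)\<close>, one factor short of the
    \<open>t ^ N\<close> on the left.\<close>
  also have "\<dots> \<le> (\<Sum>i\<le>degree f. t ^ (N - 1) * (real (coeff f i) * \<alpha> ^ i))"
  proof (rule sum_mono)
    fix i assume "i \<in> {..degree f}"
    then have "t ^ i \<le> t ^ (N - 1)" using deg t by (intro power_increasing) auto
    then have "t ^ i * (real (coeff f i) * \<alpha> ^ i) \<le> t ^ (N - 1) * (real (coeff f i) * \<alpha> ^ i)"
      using \<open>\<alpha> > 0\<close> by (intro mult_right_mono) auto
    then show "real (coeff f i) * norm z ^ i \<le> t ^ (N - 1) * (real (coeff f i) * \<alpha> ^ i)"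
      by (simp add: t power_mult_distrib algebra_simps)
  qed
  also have "\<dots> = t ^ (N - 1) * \<alpha> ^ N"
    unfolding rel by (simp add: sum_distrib_left poly_altdef coeff_map_poly degree_map_poly)
  also have "\<dots> < t ^ N * \<alpha> ^ N"
    using t \<open>\<alpha> > 0\<close> deg by (intro mult_strict_right_mono power_strict_increasing) auto
  finally show False by (simp add: t power_mult_distrib)
qed

section \<open>Divisibility by the minimal polynomial and the necessity of the weak Perron
  condition\<close>

lemma irreducible_dvd_of_common_root:
  fixes z :: "'a::field_char_0" and m f :: "rat poly"
  assumes "irreducible m" "poly (map_poly of_rat m) z = 0" "poly (map_poly of_rat f) z = 0"
  shows "m dvd f"
proof -
  let ?ev = "\<lambda>p. poly (map_poly of_rat p) z"
  let ?P = "\<lambda>p. p \<noteq> 0 \<and> ?ev p = 0"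
  have "?P m" using assms by auto
  then obtain p where p: "?P p" and pmin: "\<And>s. ?P s \<Longrightarrow> degree p \<le> degree s"
    using ex_has_least_nat[of ?P m degree] by blast
  have dvd: "p dvd s" if "?ev s = 0" for s
  proof -
    have "?ev s = ?ev (s div p * p + s mod p)" by simp
    also have "\<dots> = ?ev (s mod p)"
      using p by (simp only: map_poly_of_rat_add map_poly_of_rat_mult poly_add poly_mult) simp
    finally have "?ev (s mod p) = 0" using that by simp
    then have "s mod p = 0"
      using pmin[of "s mod p"] degree_mod_less[of p s] p by linarith
    then show ?thesis by blast
  qed
  \<comment> \<open>A nonzero constant has no root, so \<open>p\<close> is a non-unit divisor of the
    irreducible \<open>m\<close>; hence \<open>m\<close> divides \<open>p\<close>, which divides
    \<open>f\<close>.\<close>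
  have "\<not> p dvd 1" using p by (auto simp: is_unit_poly_iff map_poly_pCons)
  with irreducibleD'[OF assms(1) dvd[OF assms(2)]] dvd[OF assms(3)] show ?thesis
    by (auto intro: dvd_trans)
qed

lemma poly_of_rat_of_real:
  "poly (map_poly of_rat p) (complex_of_real x) = complex_of_real (poly (map_poly of_rat p) x)"
proof (induction p)
  case (pCons a p)
  have "(of_rat a :: complex) = of_real (of_rat a)"
    by (cases a) (simp add: of_rat_rat)
  with pCons show ?case by (simp add: map_poly_pCons)
qed simp

lemma fin_gen_imp_weak_perron:
  assumes "\<alpha> > 0" "algebraic \<alpha>" "fin_gen_monoid (nat_poly_monoid \<alpha>)"
  shows "weak_perron \<alpha>"
proof -
  obtain N and f :: "nat poly" where rel: "\<alpha> ^ N = poly (map_poly real f) \<alpha>" "degree f < N"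
    using power_relation_of_fin_gen[OF assms(3)] .
  \<comment> \<open>\<open>q\<close> is \<open>X^N - f\<close> over the rationals. Its evaluation is
    computed in an arbitrary field so that it serves both the real \<alpha> and the complex
    conjugates.\<close>
  define q :: "rat poly" where "q = monom 1 N - map_poly of_nat f"
  have q: "poly (map_poly of_rat q) x = x ^ N - poly (map_poly of_nat f) x" for x :: "'b::field_char_0"
  proof -
    have "map_poly (of_rat :: rat \<Rightarrow> 'b) q = monom 1 N - map_poly of_nat f"
      by (rule poly_eqI) (simp add: q_def coeff_map_poly of_rat_diff)
    then show ?thesis by (simp add: poly_monom)
  qed
  have m: "irreducible (min_poly \<alpha>)" "poly (map_poly of_rat (min_poly \<alpha>)) \<alpha> = 0"
    using is_min_poly_min_poly[OF assms(2)] by (auto simp: is_min_poly_def)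
  have "min_poly \<alpha> dvd q"
    using irreducible_dvd_of_common_root[OF m, of q] rel(1) unfolding q by simp
  then obtain r where r: "q = min_poly \<alpha> * r" by blast
  have "norm \<beta> \<le> \<alpha>" if "galois_conjugate \<beta> \<alpha>" for \<beta> :: complex
  proof -
    have "poly (map_poly of_rat q) \<beta> = 0"
      using that unfolding r galois_conjugate_def by (simp add: map_poly_of_rat_mult)
    then show ?thesis
      using norm_root_le_of_power_relation[OF assms(1) rel, of \<beta>] by (simp add: q)
  qed
  with assms show ?thesis by (auto simp: weak_perron_def)
qed

section \<open>Multiplicities of conjugates\<close>

text \<open>A multiple root would be shared with the derivative, so \<open>m\<close> would divide a
  nonzero polynomial of smaller degree.\<close>

lemma rsquarefree_irreducible:
  assumes "irreducible (m :: rat poly)"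
  shows "rsquarefree (map_poly of_rat m :: 'a::field_char_0 poly)"
  unfolding rsquarefree_roots
proof (intro allI notI)
  fix z :: 'a
  assume z: "poly (map_poly of_rat m) z = 0 \<and> poly (pderiv (map_poly of_rat m)) z = 0"
  have "pderiv (map_poly of_rat m) = (map_poly of_rat (pderiv m) :: 'a poly)"
    by (rule poly_eqI) (simp add: coeff_pderiv coeff_map_poly of_rat_mult of_rat_add)
  then have dvd: "m dvd pderiv m"
    using z by (intro irreducible_dvd_of_common_root[OF assms, of z]) auto
  have "degree m \<noteq> 0"
  proof
    assume "degree m = 0"
    then obtain c where "m = [:c:]" by (metis degree_eq_zeroE)
    with assms z show False by (auto simp: map_poly_pCons)
  qed
  then have "pderiv m \<noteq> 0" "degree (pderiv m) < degree m"
    by (auto simp: pderiv_eq_0_iff degree_pderiv)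
  with dvd show False using dvd_imp_degree_le by fastforce
qed

text \<open>Split off factors \<open>m\<close> one at a time: each has \<open>x\<close> and
  \<open>y\<close> as simple roots, and a cofactor not divisible by \<open>m\<close> vanishes at
  neither.\<close>

lemma order_eq_of_irreducible:
  fixes x y :: "'a::field_char_0" and m :: "rat poly"
  assumes m: "irreducible m" "poly (map_poly of_rat m) x = 0" "poly (map_poly of_rat m) y = 0"
    and "A \<noteq> 0"
  shows "order x (map_poly of_rat A) = order y (map_poly of_rat A)"
  using \<open>A \<noteq> 0\<close>
proof (induction "degree A" arbitrary: A rule: less_induct)
  case less
  show ?case
  proof (cases "m dvd A")
    case False
    then have "poly (map_poly of_rat A) x \<noteq> 0" "poly (map_poly of_rat A) y \<noteq> 0"
      using irreducible_dvd_of_common_root m by blast+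
    then show ?thesis by (simp add: order_0I)
  next
    case True
    then obtain B where B: "A = m * B" by blast
    have deg: "degree m \<noteq> 0"
    proof
      assume "degree m = 0"
      then obtain c where "m = [:c:]" by (metis degree_eq_zeroE)
      with m show False by (auto simp: map_poly_pCons)
    qed
    have B0: "B \<noteq> 0" using less.prems B by auto
    have IH: "order x (map_poly of_rat B) = order y (map_poly of_rat B)"
      using deg less.prems B B0 by (intro less.hyps) (auto simp: degree_mult_eq)
    have "map_poly of_rat m \<noteq> (0 :: 'a poly)" "map_poly of_rat B \<noteq> (0 :: 'a poly)"
      using m(1) B0 by (auto simp: map_poly_eq_0_iff)
    then show ?thesis
      using rsquarefree_irreducible[OF m(1), where ?'a = 'a] m(2,3) IH
      by (simp add: B map_poly_of_rat_mult order_mult rsquarefree_root_order)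
  qed
qed

section \<open>Newton's identities and rationality of power sums\<close>

lemma order_prod:
  fixes f :: "'b \<Rightarrow> 'a::idom poly"
  assumes "finite I" "\<And>i. i \<in> I \<Longrightarrow> f i \<noteq> 0"
  shows "order x (\<Prod>i\<in>I. f i) = (\<Sum>i\<in>I. order x (f i))"
  using assms by (induction rule: finite_induct) (auto simp: order_mult)

lemma sum_in_Rats: "(\<And>i. i \<in> I \<Longrightarrow> f i \<in> \<rat>) \<Longrightarrow> sum f I \<in> \<rat>"
  by (induction I rule: infinite_finite_induct) auto

text \<open>Newton's identities: the logarithmic derivative of \<open>\<Prod>\<^sub>i (1 - \<lambda>\<^sub>i X)\<close> is minus the
  generating function of the power sums of the \<open>\<lambda>\<^sub>i\<close>.\<close>

lemma fps_deriv_prod_linear: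
  fixes l :: "'b \<Rightarrow> 'a::field_char_0"
  assumes "finite I"
  shows "fps_deriv (\<Prod>i\<in>I. 1 - fps_const (l i) * fps_X) =
    - (\<Prod>i\<in>I. 1 - fps_const (l i) * fps_X) * Abs_fps (\<lambda>n. \<Sum>i\<in>I. l i ^ Suc n)"
  using assms
proof (induction rule: finite_induct)
  case empty
  then show ?case by (simp add: fps_zero_def[symmetric])
next
  case (insert a I)
  let ?F = "\<Prod>i\<in>I. 1 - fps_const (l i) * fps_X" and ?S = "Abs_fps (\<lambda>n. \<Sum>i\<in>I. l i ^ Suc n)"
  let ?L = "1 - fps_const (l a) * fps_X" and ?G = "Abs_fps (\<lambda>n. l a ^ Suc n)"
  have G: "?L * ?G = fps_const (l a)"
    by (rule fps_ext) (auto simp: algebra_simps fps_X_mult_nth fps_mult_left_const_nth mult.assoc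
        power_Suc[symmetric] simp del: power_Suc)
  have "fps_deriv (?L * ?F) = ?L * fps_deriv ?F - fps_const (l a) * ?F"
  proof -
    have "fps_deriv ?L = - fps_const (l a)" by simp
    then show ?thesis unfolding fps_deriv_mult by (simp only: mult_minus_left diff_conv_add_uminus)
  qed
  also have "\<dots> = ?L * fps_deriv ?F - (?L * ?G) * ?F" by (simp only: G)
  also have "\<dots> = - (?L * ?F) * (?S + ?G)"
  proof -
    have "L * (- F * S) - (L * G) * F = - (L * F) * (S + G)" for L F S G :: "'a fps"
      by (simp add: algebra_simps)
    then show ?thesis unfolding insert.IH .
  qed
  also have "?S + ?G = Abs_fps (\<lambda>n. \<Sum>i\<in>insert a I. l i ^ Suc n)"
    using insert.hyps by (intro fps_ext) simp
  finally show ?case using insert.hyps by simp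
qed

text \<open>This compares coefficients of \<open>X^n\<close> in
  \<open>fps_deriv_prod_linear\<close>. The coefficients of \<open>F\<close> are the signed
  elementary symmetric functions; as the constant one is 1, the identity can be solved for either
  the coefficients or the power sums.\<close>

lemma newton_identity:
  fixes l :: "'b \<Rightarrow> 'a::field_char_0"
  assumes "finite I"
  defines "F \<equiv> \<Prod>i\<in>I. [:1, - l i:]"
  shows "of_nat (Suc n) * coeff F (Suc n) = - (\<Sum>j\<le>n. coeff F j * (\<Sum>i\<in>I. l i ^ Suc (n - j)))"
proof -
  have lin: "fps_of_poly [:1, - l i:] = 1 - fps_const (l i) * fps_X" for i
    by (rule fps_ext) (simp add: coeff_pCons fps_X_nth split: nat.splits)
  then have "fps_of_poly F = (\<Prod>i\<in>I. 1 - fps_const (l i) * fps_X)"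
    by (simp only: F_def fps_of_poly_prod lin)
  then have "fps_nth (fps_deriv (fps_of_poly F)) n =
      fps_nth (- fps_of_poly F * Abs_fps (\<lambda>n. \<Sum>i\<in>I. l i ^ Suc n)) n"
    using fps_deriv_prod_linear[OF \<open>finite I\<close>, of l] by simp
  then show ?thesis
    by (simp add: fps_mult_nth sum_negf atLeast0AtMost del: of_nat_Suc power_Suc)
qed

lemma coeff_0_prod_linear: "coeff (\<Prod>i\<in>I. [:1, - l i:]) 0 = (1::'a::comm_ring_1)"
  by (simp add: poly_0_coeff_0[symmetric] poly_prod)

lemma reflect_prod_linear:
  fixes l :: "'b \<Rightarrow> 'a::field"
  assumes "\<And>i. i \<in> I \<Longrightarrow> l i \<noteq> 0"
  shows "reflect_poly (\<Prod>i\<in>I. [:1, - l i:]) = (\<Prod>i\<in>I. [:- l i, 1:])"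
  using assms unfolding reflect_poly_prod by (intro prod.cong) (auto simp: reflect_poly_pCons)

text \<open>Newton's recursion yields the coefficients of the reversed product, dividing only by
  positive integers. Since no \<open>l i\<close> is zero, reversal turns that product into the monic
  one.\<close>

lemma Rats_coeff_prod_linear:
  fixes l :: "'b \<Rightarrow> 'a::field_char_0"
  assumes I: "finite I" "\<And>i. i \<in> I \<Longrightarrow> l i \<noteq> 0"
    and ps: "\<And>n. (\<Sum>i\<in>I. l i ^ n) \<in> \<rat>"
  shows "coeff (\<Prod>i\<in>I. [:- l i, 1:]) n \<in> \<rat>"
proof -
  define F where "F = (\<Prod>i\<in>I. [:1, - l i:])"
  have F: "coeff F n \<in> \<rat>" for n
  proof (induction n rule: less_induct)
    case (less n)
    show ?case
    proof (cases n)
      case 0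
      then show ?thesis by (simp add: F_def coeff_0_prod_linear)
    next
      case (Suc k)
      have "coeff F n = - (\<Sum>j\<le>k. coeff F j * (\<Sum>i\<in>I. l i ^ Suc (k - j))) / of_nat n"
        using newton_identity[OF I(1), of k l] by (simp add: Suc F_def field_simps del: of_nat_Suc power_Suc)
      also have "\<dots> \<in> \<rat>"
        using less Suc by (intro Rats_divide Rats_minus_iff[THEN iffD2] sum_in_Rats Rats_mult ps) auto
      finally show ?thesis .
    qed
  qed
  moreover have "(\<Prod>i\<in>I. [:- l i, 1:]) = reflect_poly F"
    using reflect_prod_linear[where I = I and l = l, OF I(2)] by (simp add: F_def)
  ultimately show ?thesis by (simp add: coeff_reflect_poly)
qed

text \<open>The same recursion is solved for the power sum in the term \<open>j = 0\<close>, whose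
  coefficient is 1.\<close>

lemma Rats_power_sum_of_coeff:
  fixes l :: "'b \<Rightarrow> 'a::field_char_0"
  assumes I: "finite I" "\<And>i. i \<in> I \<Longrightarrow> l i \<noteq> 0"
    and cf: "\<And>n. coeff (\<Prod>i\<in>I. [:- l i, 1:]) n \<in> \<rat>"
  shows "(\<Sum>i\<in>I. l i ^ n) \<in> \<rat>"
proof (cases n)
  case (Suc k)
  define F where "F = (\<Prod>i\<in>I. [:1, - l i:])"
  have "F = reflect_poly (\<Prod>i\<in>I. [:- l i, 1:])"
    using reflect_poly_reflect_poly[of F] reflect_prod_linear[where I = I and l = l, OF I(2)]
    by (simp add: F_def coeff_0_prod_linear)
  then have F: "coeff F n \<in> \<rat>" for n by (simp add: coeff_reflect_poly cf)
  have "(\<Sum>i\<in>I. l i ^ Suc k) \<in> \<rat>" for k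
  proof (induction k rule: less_induct)
    case (less k)
    have eq: "{..k} = insert 0 {1..k}" by auto
    have "(\<Sum>i\<in>I. l i ^ Suc k) =
      - of_nat (Suc k) * coeff F (Suc k) - (\<Sum>j=1..k. coeff F j * (\<Sum>i\<in>I. l i ^ Suc (k - j)))"
      using newton_identity[OF I(1), of k l] coeff_0_prod_linear[of l I]
      by (simp add: eq F_def algebra_simps eq_neg_iff_add_eq_0 del: of_nat_Suc power_Suc)
    also have "\<dots> \<in> \<rat>"
      by (intro Rats_diff Rats_mult Rats_minus_iff[THEN iffD2] sum_in_Rats F less Rats_of_nat) auto
    finally show ?case .
  qed
  with Suc show ?thesis by blast
qed simp

text \<open>A nonzero root of \<open>X^j - c\<close> is simple, because the derivative
  \<open>j X^(j-1)\<close> vanishes only at 0 or nowhere.\<close>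

lemma order_power_diff:
  fixes x :: "'a::field_char_0"
  assumes "x \<noteq> 0" "j > 0"
  shows "order x (monom 1 j - [:c:]) = (if c = x ^ j then 1 else 0)"
proof (cases "c = x ^ j")
  case True
  let ?p = "monom 1 j - [:c:]"
  have "?p \<noteq> 0" using \<open>j > 0\<close> by (metis coeff_monom coeff_diff coeff_0 diff_0_right
    coeff_pCons_0 degree_monom_eq degree_pCons_0 eq_iff_diff_eq_0 less_irrefl zero_neq_one)
  moreover have "poly ?p x = 0" by (simp add: True poly_monom)
  moreover have "poly (pderiv ?p) x \<noteq> 0"
    using assms by (simp add: pderiv_diff pderiv_monom poly_monom pderiv_pCons)
  ultimately show ?thesis using order_pderiv[of ?p x] True by (simp add: order_0I)
qed (auto intro!: order_0I simp: poly_monom)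

text \<open>A multiplicity count replaces the Galois action: the number of \<open>\<lambda>\<^sub>i\<close> equal to \<open>x\<^sup>j\<close> is the
  order of \<open>x\<close> as a root of the rational polynomial \<open>\<Prod>\<^sub>i (X\<^sup>j - \<lambda>\<^sub>i)\<close>.\<close>

lemma card_fibre_conjugate:
  fixes l :: "'b \<Rightarrow> 'a::field_char_0"
  assumes I: "finite I" "\<And>i. i \<in> I \<Longrightarrow> l i \<noteq> 0"
    and ps: "\<And>n. (\<Sum>i\<in>I. l i ^ n) \<in> \<rat>"
    and m: "irreducible m" "poly (map_poly of_rat m) x = 0" "poly (map_poly of_rat m) y = 0"
    and "x \<noteq> 0" "y \<noteq> 0" "j > 0"
  shows "card {i\<in>I. l i = x ^ j} = card {i\<in>I. l i = y ^ j}"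
proof -
  define P where "P = (\<Prod>i\<in>I. monom 1 j - [:l i:])"
  have nz: "monom 1 j - [:c:] \<noteq> 0" for c :: 'a
  proof
    assume "monom 1 j - [:c:] = 0"
    then have "degree (monom (1::'a) j) = degree [:c:]" by simp
    with \<open>j > 0\<close> show False by (simp add: degree_monom_eq)
  qed
  have ord: "order z P = card {i\<in>I. l i = z ^ j}" if "z \<noteq> 0" for z
  proof -
    have "order z P = (\<Sum>i\<in>I. if l i = z ^ j then 1 else 0)"
      unfolding P_def using I(1) nz that \<open>j > 0\<close> by (simp add: order_prod order_power_diff)
    then show ?thesis using I(1) by (simp add: sum.If_cases Int_def)
  qed
  \<comment> \<open>Substituting \<open>X^j\<close> into the product of the \<open>X - l i\<close>
    shows that rational power sums suffice for \<open>P\<close> to be rational, even if the single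
    \<open>l i\<close> are not.\<close>
  have "P = pcompose (\<Prod>i\<in>I. [:- l i, 1:]) (monom 1 j)"
    unfolding P_def pcompose_prod by (intro prod.cong refl poly_eqI) (simp add: pcompose_pCons coeff_pCons split: nat.splits)
  then have "coeff P n \<in> \<rat>" for n
    using Rats_coeff_prod_linear[OF I ps]
    by (auto intro!: coeff_pcompose_semiring_closed)
  then obtain Q where Q: "P = map_poly of_rat Q" by (rule ratpolyE)
  have "P \<noteq> 0" unfolding P_def using I(1) nz by simp
  then have "Q \<noteq> 0" using Q by auto
  then have "order x P = order y P" unfolding Q by (intro order_eq_of_irreducible[OF m])
  with ord assms show ?thesis by simp
qed

section \<open>Integrality of the minimal polynomial\<close>

lemma clear_denominators:
  fixes r :: "rat poly"
  obtains a :: int and R :: "int poly" where "a > 0" "smult (of_int a) r = map_poly of_int R"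
proof (induction r arbitrary: thesis)
  case 0
  show ?case by (rule 0[of 1 0]) auto
next
  case (pCons c r)
  obtain a R where aR: "a > 0" "smult (of_int a) r = map_poly of_int R" using pCons.IH by blast
  obtain u d where ud: "c = Rat.Fract u d" "d > 0" by (cases c) auto
  have "smult (of_int (a * d)) r = smult (of_int d) (map_poly of_int R)"
    using aR(2) by (metis mult.commute of_int_mult smult_smult)
  also have "\<dots> = map_poly of_int (smult d R)"
    by (rule poly_eqI) (simp add: coeff_map_poly)
  finally have "smult (of_int (a * d)) (pCons c r) = map_poly of_int (pCons (a * u) (smult d R))"
    using ud by (simp add: map_poly_pCons Fract_of_int_quotient)
  with aR(1) ud(2) show ?case by (intro pCons.prems[of "a * d"]) auto
qed

lemma map_poly_of_int_mult:
  "map_poly (of_int :: int \<Rightarrow> 'a::comm_ring_1) (p * q) = map_poly of_int p * map_poly of_int q"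
  by (rule poly_eqI) (simp add: coeff_map_poly coeff_mult)

lemma map_poly_of_int_add:
  "map_poly (of_int :: int \<Rightarrow> 'a::comm_ring_1) (p + q) = map_poly of_int p + map_poly of_int q"
  by (rule poly_eqI) (simp add: coeff_map_poly)

text \<open>Gauss's lemma: clear denominators in both factors and compare contents.\<close>

lemma monic_factor_integral:
  fixes m q :: "rat poly" and p :: "int poly"
  assumes pmq: "map_poly of_int p = m * q" and lc: "lead_coeff p = 1" "lead_coeff m = 1"
  obtains mi where "m = map_poly of_int mi"
proof -
  have lq: "lead_coeff q = 1"
  proof -
    have "lead_coeff (map_poly of_int p :: rat poly) = 1"
      using lc(1) by (simp add: degree_map_poly coeff_map_poly)
    with pmq lc(2) show ?thesis by (simp add: lead_coeff_mult)
  qed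
  obtain a M where M: "a > 0" "smult (of_int a) m = map_poly of_int M" by (rule clear_denominators)
  obtain b Q where Q: "b > 0" "smult (of_int b) q = map_poly of_int Q" by (rule clear_denominators)
  have lcM: "lead_coeff M = a" 
  proof -
    have "of_int (lead_coeff M) = lead_coeff (map_poly of_int M :: rat poly)"
      by (simp add: degree_map_poly coeff_map_poly)
    also have "\<dots> = of_int a" unfolding M(2)[symmetric] using lc(2) M(1) by simp
    finally show ?thesis by simp
  qed
  have lcQ: "lead_coeff Q = b" 
  proof -
    have "of_int (lead_coeff Q) = lead_coeff (map_poly of_int Q :: rat poly)"
      by (simp add: degree_map_poly coeff_map_poly)
    also have "\<dots> = of_int b" unfolding Q(2)[symmetric] using lq Q(1) by simp
    finally show ?thesis by simp
  qed
  have "map_poly of_int (smult (a * b) p) = (map_poly of_int (M * Q) :: rat poly)"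
  proof -
    have "map_poly of_int (M * Q) = smult (of_int a) m * smult (of_int b) q"
      by (simp add: map_poly_of_int_mult M Q)
    also have "\<dots> = smult (of_int (a * b)) (map_poly of_int p)" by (simp add: pmq mult.commute)
    also have "\<dots> = map_poly of_int (smult (a * b) p)"
      by (rule poly_eqI) (simp add: coeff_map_poly)
    finally show ?thesis by simp
  qed
  then have "of_int (coeff (smult (a * b) p) i) = (of_int (coeff (M * Q) i) :: rat)" for i
    by (metis coeff_map_poly of_int_0)
  then have eq: "smult (a * b) p = M * Q" by (intro poly_eqI) (simp only: of_int_eq_iff)
  \<comment> \<open>A monic polynomial is primitive, so the content of \<open>M * Q\<close> is
    exactly \<open>a * b\<close>.\<close>
  have "content p dvd 1" using content_dvd_coeff[of p "degree p"] lc(1) by simp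
  then have "content p = 1" using normalize_content[of p] by (simp add: is_unit_normalize)
  then have cont: "a * b = content M * content Q"
    using arg_cong[OF eq, of content] M(1) Q(1) by (simp add: content_mult)
  have "content M dvd a" "content Q dvd b"
    using content_dvd_coeff[of M "degree M"] content_dvd_coeff[of Q "degree Q"] lcM lcQ by simp_all
  then have le: "content M \<le> a" "content Q \<le> b" using M(1) Q(1) by (auto dest: zdvd_imp_le)
  have nonneg: "content M \<ge> 0" "content Q \<ge> 0"
    using normalize_content[of M] normalize_content[of Q] by (metis abs_ge_zero normalize_int_def)+
  \<comment> \<open>Each content is bounded by its leading coefficient, \<open>a\<close> or
    \<open>b\<close>. Their product attains the bound, so neither inequality is strict and the
    denominator \<open>a\<close> cancels.\<close>
  have "content M = a"
  proof (rule ccontr)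
    assume "content M \<noteq> a"
    moreover have "content Q \<noteq> 0" using lcQ Q(1) by auto
    ultimately have "content M * content Q < a * b"
      using le nonneg Q(1) by (intro mult_less_le_imp_less) (auto simp: order_less_le cont)
    with cont show False by simp
  qed
  then have "smult a (primitive_part M) = M" using content_times_primitive_part[of M] by simp
  then have "smult (of_int a) m = smult (of_int a) (map_poly of_int (primitive_part M))"
    unfolding M(2) by (intro poly_eqI) (metis coeff_map_poly coeff_smult of_int_0 of_int_mult)
  then have "m = map_poly of_int (primitive_part M)"
    using M(1) by (auto simp: poly_eq_iff)
  then show ?thesis by (rule that)
qed

text \<open>The minimal polynomial is a monic rational factor of a monic integer polynomial with
  root \<alpha>.\<close>

lemma min_poly_integral:
  fixes \<alpha> :: real
  assumes "algebraic_int \<alpha>"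
  obtains mi :: "int poly" where "min_poly \<alpha> = map_poly of_int mi"
proof -
  obtain p :: "int poly" where p: "poly (map_poly of_int p) \<alpha> = 0" "lead_coeff p = 1"
    using assms unfolding algebraic_int_altdef_ipoly by blast
  have mp: "is_min_poly \<alpha> (min_poly \<alpha>)" using assms by (intro is_min_poly_min_poly) auto
  have "map_poly of_rat (map_poly of_int p) = (map_poly of_int p :: real poly)"
    by (rule poly_eqI) (simp add: coeff_map_poly)
  with p(1) mp have "min_poly \<alpha> dvd map_poly of_int p"
    by (intro irreducible_dvd_of_common_root[of _ \<alpha>]) (auto simp: is_min_poly_def)
  then obtain q where "map_poly of_int p = min_poly \<alpha> * q" by blast
  with p(2) mp that show ?thesis
    using monic_factor_integral[of p "min_poly \<alpha>" q] by (auto simp: is_min_poly_def)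
qed

text \<open>Rotating \<open>z\<close> by its own argument in steps of at most \<open>\<pi>/2\<close> cannot jump over the left half plane.\<close>

lemma ex_power_Re_nonpos:
  fixes z :: complex
  assumes "\<not> (Im z = 0 \<and> Re z \<ge> 0)"
  obtains n where "n > 0" "Re (z ^ n) \<le> 0"
proof -
  define t where "t = \<bar>Arg z\<bar>"
  have "Arg z \<noteq> 0"
  proof
    assume "Arg z = 0"
    then have "z = of_real (cmod z)" using rcis_cmod_Arg[of z] by (simp add: rcis_def)
    then have "Im z = 0 \<and> Re z \<ge> 0" by (metis Im_complex_of_real Re_complex_of_real norm_ge_zero)
    with assms show False by simp
  qed
  then have t: "0 < t" "t \<le> pi" using Arg_bounded[of z] by (auto simp: t_def)
  have Re: "Re (z ^ n) = cmod z ^ n * cos (real n * t)" for n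
  proof -
    have "z ^ n = rcis (cmod z ^ n) (real n * Arg z)"
      by (metis DeMoivre2 rcis_cmod_Arg)
    moreover have "cos (real n * Arg z) = cos (real n * t)"
      by (simp add: t_def abs_if)
    ultimately show ?thesis by (simp add: Re_rcis)
  qed
  show ?thesis
  proof (cases "t \<ge> pi / 2")
    case True
    then have "cos t \<le> 0" using cos_monotone_0_pi_le[of "pi / 2" t] t by simp
    then show ?thesis using Re[of 1] by (intro that[of 1]) (auto simp: mult_nonneg_nonpos)
  next
    case False
    \<comment> \<open>After \<open>n\<close> steps the angle first reaches \<open>pi / 2\<close>; as
      a step is shorter than \<open>pi / 2\<close>, the angle is then still below
      \<open>pi\<close>.\<close>
    define n where "n = nat \<lceil>(pi / 2) / t\<rceil>"
    have pos: "(pi / 2) / t > 0" using t by simp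
    have lb: "real n \<ge> (pi / 2) / t" unfolding n_def by (simp add: real_nat_ceiling_ge)
    have "real n < (pi / 2) / t + 1"
      unfolding n_def using pos by linarith
    then have "real n * t < pi / 2 + t" using t by (simp add: field_simps)
    moreover have "real n * t \<ge> pi / 2" using lb t by (simp add: field_simps)
    ultimately have "cos (real n * t) \<le> 0"
      using cos_monotone_0_pi_le[of "pi / 2" "real n * t"] False by simp
    moreover have "n > 0" using lb pos by (cases n) auto
    ultimately show ?thesis using Re[of n] by (intro that[of n]) (auto simp: mult_nonneg_nonpos)
  qed
qed

section \<open>Polynomials with positive coefficients\<close>

lemma coeff_mult_nonneg:
  fixes p q :: "'a::linordered_idom poly"
  shows "(\<And>i. coeff p i \<ge> 0) \<Longrightarrow> (\<And>i. coeff q i \<ge> 0) \<Longrightarrow> coeff (p * q) i \<ge> 0"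
  unfolding coeff_mult by (intro sum_nonneg mult_nonneg_nonneg)

lemma coeff_prod_nonneg:
  fixes f :: "'b \<Rightarrow> 'a::linordered_idom poly"
  assumes "\<And>x i. x \<in> I \<Longrightarrow> coeff (f x) i \<ge> 0"
  shows "coeff (prod f I) i \<ge> 0"
  using assms
  by (induction I arbitrary: i rule: infinite_finite_induct) (auto intro!: coeff_mult_nonneg simp: coeff_1)

lemma lead_coeff_pos:
  fixes p :: "real poly"
  assumes "\<And>i. coeff p i \<ge> 0" "p \<noteq> 0"
  shows "lead_coeff p > 0"
proof -
  have "lead_coeff p \<ge> 0" by (rule assms(1))
  moreover have "lead_coeff p \<noteq> 0" using assms(2) by simp
  ultimately show ?thesis by linarith
qed

lemma poly_pos_of_coeff_nonneg:
  fixes p :: "real poly"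
  assumes nonneg: "\<And>i. coeff p i \<ge> 0" and "p \<noteq> 0" "x > 0"
  shows "poly p x > 0"
proof -
  have "0 < lead_coeff p * x ^ degree p"
    using lead_coeff_pos[OF assms(1,2)] \<open>x > 0\<close> by (intro mult_pos_pos zero_less_power)
  also have "\<dots> \<le> (\<Sum>i\<le>degree p. coeff p i * x ^ i)"
  proof (rule member_le_sum[of "degree p" "{..degree p}" "\<lambda>i. coeff p i * x ^ i"])
    show "0 \<le> coeff p i * x ^ i" for i using nonneg \<open>x > 0\<close> by (intro mult_nonneg_nonneg) auto
  qed simp_all
  finally show ?thesis by (simp only: poly_altdef)
qed

text \<open>The factor \<open>1 + X + ... + X^M\<close> fills gaps: indices up to \<open>M\<close>
  receive the constant coefficient of \<open>F\<close>, larger ones the leading coefficient. The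
  bound \<open>degree F \<le> M\<close> leaves no index uncovered.\<close>

lemma coeff_mult_geometric_pos:
  fixes F :: "real poly"
  assumes nonneg: "\<And>i. coeff F i \<ge> 0" and "coeff F 0 > 0" and "degree F \<le> M"
    and i: "i \<le> M + degree F"
  shows "coeff (F * (\<Sum>j\<le>M. monom 1 j)) i > 0"
proof -
  let ?G = "\<Sum>j\<le>M. monom (1::real) j"
  have G: "coeff ?G k = (if k \<le> M then 1 else 0)" for k
    by (simp add: coeff_sum)
  have "coeff F (degree F) > 0"
    using \<open>coeff F 0 > 0\<close> by (intro lead_coeff_pos nonneg) auto
  define k where "k = (if i \<le> M then 0 else degree F)"
  have k: "k \<le> i" "coeff F k > 0" "i - k \<le> M"
    using assms(2-) \<open>coeff F (degree F) > 0\<close> by (auto simp: k_def)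
  have "0 < coeff F k * coeff ?G (i - k)" using k(2,3) by (simp add: G)
  also have "\<dots> \<le> (\<Sum>k\<le>i. coeff F k * coeff ?G (i - k))"
  proof (rule member_le_sum[of k "{..i}" "\<lambda>k. coeff F k * coeff ?G (i - k)"])
    show "0 \<le> coeff F k * coeff ?G (i - k)" for k using nonneg[of k] by (simp add: G)
  qed (use k in simp_all)
  finally show ?thesis by (simp add: coeff_mult)
qed

text \<open>With \<open>w = z\<^sup>n\<close> the factor is \<open>(X\<^sup>n - w) (X\<^sup>n - cnj w)\<close>.\<close>

lemma ex_nonneg_poly_with_root:
  fixes z :: complex
  assumes "\<not> (Im z = 0 \<and> Re z \<ge> 0)"
  obtains F :: "real poly" where "\<And>i. coeff F i \<ge> 0" "coeff F 0 > 0"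
    "poly (map_poly of_real F) z = 0"
proof -
  obtain n where n: "n > 0" "Re (z ^ n) \<le> 0" using ex_power_Re_nonpos[OF assms] .
  define w where "w = z ^ n"
  define F :: "real poly" where "F = monom 1 (2 * n) + monom (- 2 * Re w) n + [:(cmod w)\<^sup>2:]"
  have "z \<noteq> 0" using assms by auto
  then have "w \<noteq> 0" by (simp add: w_def)
  have "map_poly of_real F = monom 1 (2 * n) + monom (of_real (- 2 * Re w)) n + [:of_real ((cmod w)\<^sup>2) :: complex:]"
    by (rule poly_eqI) (simp add: F_def coeff_map_poly coeff_pCons split: nat.splits)
  then have "poly (map_poly of_real F) z = w\<^sup>2 - 2 * Re w * w + of_real ((cmod w)\<^sup>2)"
    by (simp add: poly_monom w_def power_mult power_mult_distrib mult.commute[of 2])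
  also have "\<dots> = 0"
  proof -
    have "of_real ((cmod w)\<^sup>2) = w * cnj w" "2 * complex_of_real (Re w) = w + cnj w"
      by (rule complex_norm_square) (simp add: complex_eq_iff)
    then show ?thesis by (simp only:) (simp add: algebra_simps power2_eq_square)
  qed
  finally have root: "poly (map_poly of_real F) z = 0" .
  have "coeff F i \<ge> 0" for i
    using n by (auto simp: F_def w_def coeff_pCons split: nat.splits)
  moreover have "coeff F 0 > 0" using n \<open>w \<noteq> 0\<close> by (simp add: F_def coeff_pCons)
  ultimately show ?thesis using root by (rule that)
qed

lemma map_poly_of_real_mult:
  "map_poly (of_real :: real \<Rightarrow> complex) (p * q) = map_poly of_real p * map_poly of_real q"
  by (rule poly_eqI) (simp add: coeff_map_poly coeff_mult)

lemma map_poly_of_real_add: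
  "map_poly (of_real :: real \<Rightarrow> complex) (p + q) = map_poly of_real p + map_poly of_real q"
  by (rule poly_eqI) (simp add: coeff_map_poly)

lemma poly_of_real_of_real:
  "poly (map_poly of_real p) (complex_of_real x) = of_real (poly p x)"
  by (induction p) (auto simp: map_poly_pCons)

text \<open>Multiply one nonnegative polynomial per root, fill the gaps by a geometric factor and
  rescale at \<open>A\<close>. The free \<open>d\<close> lengthens the geometric factor and so makes
  the degree as large as desired.\<close>

lemma ex_pos_poly_with_roots:
  fixes Z :: "complex set" and A :: real
  assumes "finite Z" "\<And>z. z \<in> Z \<Longrightarrow> \<not> (Im z = 0 \<and> Re z \<ge> 0)" "A > 0"
  obtains E :: "real poly" where "degree E \<ge> d" "\<And>i. i \<le> degree E \<Longrightarrow> coeff E i > 0"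
    "poly E A = 1" "\<And>z. z \<in> Z \<Longrightarrow> poly (map_poly of_real E) z = 0"
proof -
  have "\<forall>z\<in>Z. \<exists>F :: real poly. (\<forall>i. coeff F i \<ge> 0) \<and> coeff F 0 > 0 \<and> poly (map_poly of_real F) z = 0"
    using assms(2) ex_nonneg_poly_with_root by metis
  then obtain f :: "complex \<Rightarrow> real poly" where f: "\<And>z i. z \<in> Z \<Longrightarrow> coeff (f z) i \<ge> 0"
      "\<And>z. z \<in> Z \<Longrightarrow> coeff (f z) 0 > 0" "\<And>z. z \<in> Z \<Longrightarrow> poly (map_poly of_real (f z)) z = 0"
    by metis
  define F where "F = prod f Z"
  define M where "M = degree F + d"
  define G where "G = (\<Sum>j\<le>M. monom (1::real) j)"
  have F: "coeff F i \<ge> 0" for i unfolding F_def using f(1) by (rule coeff_prod_nonneg)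
  have "coeff F 0 = (\<Prod>z\<in>Z. coeff (f z) 0)"
    by (simp only: F_def poly_prod poly_0_coeff_0[symmetric])
  then have F0: "coeff F 0 > 0" using f(2) by (simp add: prod_pos)
  have pos: "coeff (F * G) i > 0" if "i \<le> M + degree F" for i
    unfolding G_def using F F0 that by (intro coeff_mult_geometric_pos) (auto simp: M_def)
  have "degree G \<le> M" unfolding G_def by (intro degree_sum_le) (auto intro: order_trans[OF degree_monom_le])
  then have deg: "degree (F * G) = M + degree F"
    using pos[of "M + degree F"] degree_mult_le[of F G] le_degree[of "F * G" "M + degree F"] by simp
  have val: "poly (F * G) A > 0"
  proof (rule poly_pos_of_coeff_nonneg)
    show "coeff (F * G) i \<ge> 0" for i
      using pos[of i] deg by (cases "i \<le> M + degree F") (auto simp: coeff_eq_0)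
    show "F * G \<noteq> 0" using pos[of 0] by auto
  qed fact
  have root: "poly (map_poly of_real (F * G)) z = 0" if "z \<in> Z" for z
  proof -
    have "F * G = f z * (prod f (Z - {z}) * G)"
      using prod.remove[OF \<open>finite Z\<close> that, of f] by (simp add: F_def mult.assoc)
    then have "poly (map_poly of_real (F * G)) z =
        poly (map_poly of_real (f z)) z * poly (map_poly of_real (prod f (Z - {z}) * G)) z"
      by (simp only: map_poly_of_real_mult poly_mult)
    with f(3)[OF that] show ?thesis by simp
  qed
  define E where "E = smult (1 / poly (F * G) A) (F * G)"
  have "map_poly of_real E = smult (of_real (1 / poly (F * G) A)) (map_poly complex_of_real (F * G))"
    unfolding E_def by (rule poly_eqI) (simp add: coeff_map_poly)
  then have "poly (map_poly of_real E) z = 0" if "z \<in> Z" for z using root[OF that] by simp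
  moreover have "degree E = M + degree F" "poly E A = 1"
    using val deg by (auto simp: E_def)
  moreover have "coeff E i > 0" if "i \<le> M + degree F" for i
    using val pos[OF that] by (simp add: E_def)
  ultimately show ?thesis using that[of E] by (simp add: M_def)
qed

section \<open>Integer division, interpolation and rounding\<close>

lemma monic_int_power_division:
  fixes g :: "int poly"
  assumes "lead_coeff g = 1"
  obtains q r where "monom 1 n = g * q + r" "r = 0 \<or> degree r < degree g"
proof -
  obtain q r where qr: "pseudo_divmod (monom 1 n) g = (q, r)" by force
  have "g \<noteq> 0" using assms by auto
  \<comment> \<open>Pseudo-division scales the dividend by a power of the leading coefficient, here
    1, so it is genuine division over the integers.\<close>
  from pseudo_divmod[OF this qr] assms that show ?thesis by simp
qed

lemma lagrange_basis:
  fixes Z :: "'a::field set"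
  assumes "finite Z" "z \<in> Z"
  obtains B where "degree B < card Z" "\<And>z'. z' \<in> Z \<Longrightarrow> poly B z' = (if z' = z then 1 else 0)"
proof -
  define P where "P = (\<Prod>y\<in>Z - {z}. [:- y, 1:])"
  have "poly P z \<noteq> 0" using assms by (auto simp: P_def poly_prod)
  moreover have "poly P z' = 0" if "z' \<in> Z" "z' \<noteq> z" for z'
    using assms that by (auto simp: P_def poly_prod intro!: prod_zero)
  moreover have "degree P = card Z - 1"
    using assms by (simp add: P_def degree_prod_eq_sum_degree)
  moreover have "card Z > 0" using assms by (auto simp: card_gt_0_iff)
  ultimately show ?thesis by (intro that[of "smult (1 / poly P z) P"]) auto
qed

lemma floor_scaled_tendsto:
  fixes A c :: real
  assumes "A > 1"
  shows "(\<lambda>n. of_int \<lfloor>A ^ n * c\<rfloor> / A ^ n) \<longlonglongrightarrow> c"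
proof (rule tendsto_sandwich[of "\<lambda>n. c - inverse (A ^ n)" _ _ "\<lambda>n. c"])
  have "c - inverse (A ^ n) \<le> of_int \<lfloor>A ^ n * c\<rfloor> / A ^ n \<and> of_int \<lfloor>A ^ n * c\<rfloor> / A ^ n \<le> c" for n
  proof -
    have pos: "A ^ n > 0" using assms by simp
    have "(A ^ n * c - 1) / A ^ n \<le> of_int \<lfloor>A ^ n * c\<rfloor> / A ^ n"
      using pos by (intro divide_right_mono) linarith+
    moreover have "of_int \<lfloor>A ^ n * c\<rfloor> / A ^ n \<le> (A ^ n * c) / A ^ n"
      using pos by (intro divide_right_mono) linarith+
    ultimately show ?thesis using assms by (simp add: diff_divide_distrib inverse_eq_divide)
  qed
  then show "\<forall>\<^sub>F n in sequentially. c - inverse (A ^ n) \<le> of_int \<lfloor>A ^ n * c\<rfloor> / A ^ n"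
    "\<forall>\<^sub>F n in sequentially. of_int \<lfloor>A ^ n * c\<rfloor> / A ^ n \<le> c"
    by simp_all
  show "(\<lambda>n. c - inverse (A ^ n)) \<longlonglongrightarrow> c"
    using tendsto_diff[OF tendsto_const LIMSEQ_inverse_realpow_zero[OF assms], of c] by simp
qed simp

section \<open>A strictly dominant root\<close>

lemma poly_of_int_of_real:
  "poly (map_poly of_int p) (complex_of_real x) = of_real (poly (map_poly of_int p) x)"
  by (induction p) (auto simp: map_poly_pCons)

text \<open>The product of the moduli of the roots is the absolute value of the constant
  coefficient, a nonzero integer, so the roots cannot all have modulus below 1.\<close>

lemma dominant_root_ge_1:
  fixes g :: "int poly" and A :: real
  assumes monic: "lead_coeff g = 1"
    and Z: "Z = {z :: complex. poly (map_poly of_int g) z = 0}"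
    and card: "card Z = degree g" and "finite Z"
    and "0 \<notin> Z" and dom: "\<And>z. z \<in> Z \<Longrightarrow> norm z \<le> A" and "Z \<noteq> {}"
  shows "A \<ge> 1"
proof (rule ccontr)
  assume "\<not> A \<ge> 1"
  let ?G = "map_poly of_int g :: complex poly"
  have [simp]: "degree ?G = degree g" by (simp add: degree_map_poly)
  have "?G = (\<Prod>z\<in>Z. [:- z, 1:])"
  proof (rule poly_eqI_degree_lead_coeff[of _ "degree g" _ Z])
    have "degree (\<Prod>z\<in>Z. [:- z, 1:]) = degree g"
      by (simp add: degree_prod_eq_sum_degree card)
    moreover have "lead_coeff (\<Prod>z\<in>Z. [:- z, 1:]) = 1" by (simp add: lead_coeff_prod)
    ultimately show "coeff ?G (degree g) = coeff (\<Prod>z\<in>Z. [:- z, 1:]) (degree g)"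
      "degree (\<Prod>z\<in>Z. [:- z, 1:]) \<le> degree g"
      using monic by (simp_all add: coeff_map_poly)
    show "poly ?G z = poly (\<Prod>z\<in>Z. [:- z, 1:]) z" if "z \<in> Z" for z
    proof -
      have "poly (\<Prod>z\<in>Z. [:- z, 1:]) z = 0"
        using that \<open>finite Z\<close> by (auto simp: poly_prod intro!: prod_zero)
      then show ?thesis using that by (simp add: Z)
    qed
  qed (simp_all add: card)
  then have "poly ?G 0 = (\<Prod>z\<in>Z. - z)" by (simp add: poly_prod)
  moreover have "poly ?G 0 = of_int (coeff g 0)" by (simp add: poly_0_coeff_0 coeff_map_poly)
  ultimately have "norm (of_int (coeff g 0) :: complex) = norm (\<Prod>z\<in>Z. - z)" by simp
  also have "\<dots> = (\<Prod>z\<in>Z. norm (- z))" by (rule prod_norm[symmetric])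
  finally have eq: "\<bar>real_of_int (coeff g 0)\<bar> = (\<Prod>z\<in>Z. norm z)" by simp
  obtain z0 where z0: "z0 \<in> Z" using \<open>Z \<noteq> {}\<close> by blast
  have "(\<Prod>z\<in>Z. norm z) = norm z0 * (\<Prod>z\<in>Z - {z0}. norm z)"
    using z0 \<open>finite Z\<close> by (simp add: prod.remove)
  also have "\<dots> \<le> norm z0 * 1"
  proof (rule mult_left_mono)
    show "(\<Prod>z\<in>Z - {z0}. norm z) \<le> 1"
      using dom \<open>\<not> A \<ge> 1\<close> by (intro prod_le_1) force
  qed simp
  also have "\<dots> < 1" using dom[OF z0] \<open>\<not> A \<ge> 1\<close> by simp
  finally have "\<bar>real_of_int (coeff g 0)\<bar> < 1" by (simp add: eq)
  then have "coeff g 0 = 0" by linarith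
  with eq have "(\<Prod>z\<in>Z. norm z) = 0" by simp
  with \<open>finite Z\<close> \<open>0 \<notin> Z\<close> show False by (simp add: prod_zero_iff)
qed

text \<open>The remainder of \<open>X\<^sup>n\<close> modulo \<open>g\<close> grows like \<open>A\<^sup>n\<close> times the Lagrange polynomial \<open>L\<close>
  of the dominant root, so all its coefficients follow the signs of those of \<open>L\<close>.\<close>

lemma remainder_coeff_tendsto:
  fixes g :: "int poly" and A :: real and r :: "nat \<Rightarrow> int poly" and L :: "real poly"
  assumes Z: "Z = {z :: complex. poly (map_poly of_int g) z = 0}"
    and card: "card Z = degree g" and "finite Z"
    and A: "A > 0" "of_real A \<in> Z" and dom: "\<And>z. z \<in> Z \<Longrightarrow> z \<noteq> of_real A \<Longrightarrow> norm z < A"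
    and r: "\<And>n. monom 1 n = g * q n + r n" "\<And>n. degree (r n) < degree g"
    and L: "degree L < degree g" "poly L A = 1"
      "\<And>z. z \<in> Z \<Longrightarrow> z \<noteq> of_real A \<Longrightarrow> poly (map_poly of_real L) z = 0"
  shows "(\<lambda>n. of_int (coeff (r n) i) / A ^ n) \<longlonglongrightarrow> coeff L i"
proof -
  have "\<forall>z\<in>Z. \<exists>B. degree B < card Z \<and> (\<forall>z'\<in>Z. poly B z' = (if z' = z then 1 else 0))"
    using lagrange_basis[OF \<open>finite Z\<close>] by metis
  then obtain B where B: "\<And>z. z \<in> Z \<Longrightarrow> degree (B z) < card Z"
      "\<And>z z'. z \<in> Z \<Longrightarrow> z' \<in> Z \<Longrightarrow> poly (B z) z' = (if z' = z then 1 else 0)"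
    by (metis (no_types, lifting))
  have interp: "p = (\<Sum>z\<in>Z. smult (poly p z) (B z))" if "degree p < card Z" for p
  proof (rule poly_eqI_degree[of Z])
    show "card Z > degree (\<Sum>z\<in>Z. smult (poly p z) (B z))"
      using B(1) that by (intro degree_sum_less) (auto intro: le_less_trans[OF degree_smult_le])
    show "poly p z = poly (\<Sum>z\<in>Z. smult (poly p z) (B z)) z" if "z \<in> Z" for z
      using that \<open>finite Z\<close> by (simp add: poly_sum B sum.delta if_distrib[of "(*) _"] cong: if_cong)
  qed fact
  have rval: "poly (map_poly of_int (r n)) z = z ^ n" if "z \<in> Z" for n z
  proof -
    have "poly (map_poly of_int (monom 1 n)) z = poly (map_poly of_int (r n)) z"
      unfolding r(1)[of n] using that by (simp add: map_poly_of_int_add map_poly_of_int_mult Z)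
    then show ?thesis by (simp add: map_poly_monom poly_monom)
  qed
  \<comment> \<open>Reduction modulo \<open>g\<close> keeps the value \<open>z ^ n\<close> at each
    root, and interpolation turns these values into coefficients. After division by
    \<open>A ^ n\<close> only the term of \<open>A\<close> survives in the limit.\<close>
  have rco: "of_int (coeff (r n) i) = (\<Sum>z\<in>Z. z ^ n * coeff (B z) i)" for n
  proof -
    have "map_poly of_int (r n) = (\<Sum>z\<in>Z. smult (z ^ n) (B z))"
      using interp[of "map_poly of_int (r n)"] r(2)[of n] by (simp add: degree_map_poly card rval)
    from arg_cong[OF this, of "\<lambda>p. coeff p i"] show ?thesis
      by (simp add: coeff_map_poly coeff_sum)
  qed
  \<comment> \<open>\<open>L\<close> takes the same values on \<open>Z\<close> as the basis
    polynomial of \<open>A\<close>, and both have degree below \<open>card Z\<close>.\<close>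
  have LB: "of_real (coeff L i) = coeff (B (of_real A)) i"
  proof -
    have "poly (map_poly of_real L) z = (if z = of_real A then 1 else 0)" if "z \<in> Z" for z
      using L that by (simp add: poly_of_real_of_real)
    then have "map_poly of_real L = B (of_real A)"
      using L(1) B A by (intro poly_eqI_degree[of Z]) (auto simp: degree_map_poly card)
    from arg_cong[OF this, of "\<lambda>p. coeff p i"] show ?thesis by (simp add: coeff_map_poly)
  qed
  have lim: "(\<lambda>n. (z / of_real A) ^ n * coeff (B z) i) \<longlonglongrightarrow> (if z = of_real A then coeff (B z) i else 0)"
    if "z \<in> Z" for z
  proof (cases "z = of_real A")
    case True
    then show ?thesis using A by simp
  next
    case False
    then have "norm (z / of_real A) < 1" using dom[OF that] A by (simp add: norm_divide)
    from tendsto_mult_left_zero[OF LIMSEQ_power_zero[OF this]] show ?thesis using False by simp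
  qed
  have "(\<lambda>n. \<Sum>z\<in>Z. (z / of_real A) ^ n * coeff (B z) i) \<longlonglongrightarrow>
      (\<Sum>z\<in>Z. if z = of_real A then coeff (B z) i else 0)"
    by (intro tendsto_sum lim)
  also have "(\<Sum>z\<in>Z. if z = of_real A then coeff (B z) i else 0) = of_real (coeff L i)"
    using \<open>finite Z\<close> A by (simp add: sum.delta LB)
  also have "(\<lambda>n. \<Sum>z\<in>Z. (z / of_real A) ^ n * coeff (B z) i) =
      (\<lambda>n. complex_of_real (of_int (coeff (r n) i) / A ^ n))"
    by (rule ext) (simp add: rco sum_divide_distrib power_divide)
  finally show ?thesis by (simp only: tendsto_of_real_iff)
qed

text \<open>\<open>card\<close> makes the roots of \<open>g\<close> simple, so remainders are
  determined by their values there; \<open>pos\<close> keeps the other roots off the half-line where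
  a polynomial with positive coefficients cannot vanish.\<close>

lemma strictly_dominant_power_relation:
  fixes g :: "int poly" and A :: real
  assumes monic: "lead_coeff g = 1"
    and Z: "Z = {z :: complex. poly (map_poly of_int g) z = 0}"
    and card: "card Z = degree g"
    and A: "A > 0" "of_real A \<in> Z" and dom: "\<And>z. z \<in> Z \<Longrightarrow> z \<noteq> of_real A \<Longrightarrow> norm z < A"
    and pos: "\<And>z. z \<in> Z \<Longrightarrow> Im z = 0 \<Longrightarrow> Re z \<ge> 0 \<Longrightarrow> z = of_real A"
  obtains n and f :: "nat poly" where "degree f < n" "A ^ n = poly (map_poly real f) A"
proof -
  have "g \<noteq> 0" using monic by auto
  then have fin: "finite Z" unfolding Z by (intro poly_roots_finite) (simp add: map_poly_eq_0_iff)
  have "0 \<notin> Z" using pos[of 0] A by auto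
  then have "A \<ge> 1"
    using A dom by (intro dominant_root_ge_1[OF monic Z card fin]) force+
  then consider "A = 1" | "A > 1" by linarith
  then show ?thesis
  proof cases
    case 1
    then show ?thesis by (intro that[of "[:1:]" 1]) (auto simp: map_poly_pCons)
  next
    case 2
    define gr where "gr = map_poly real_of_int g"
    have deg_gr: "degree gr = degree g" by (simp add: gr_def degree_map_poly)
    have gr_of_real: "map_poly complex_of_real gr = map_poly of_int g"
      by (rule poly_eqI) (simp add: gr_def coeff_map_poly)
    have grA: "poly gr A = 0"
      using A(2) unfolding Z gr_def by (simp add: poly_of_int_of_real)
    have "degree g > 0" using card A(2) fin by (metis card_gt_0_iff empty_iff)
    \<comment> \<open>Degree at least \<open>degree g\<close> makes the positive coefficients of
      \<open>E\<close> cover every index at which a remainder \<open>r n\<close> can be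
      nonzero.\<close>
    obtain E :: "real poly" where E: "degree E \<ge> degree g" "\<And>i. i \<le> degree E \<Longrightarrow> coeff E i > 0"
        "poly E A = 1" "\<And>z. z \<in> Z - {of_real A} \<Longrightarrow> poly (map_poly of_real E) z = 0"
      using ex_pos_poly_with_roots[of "Z - {of_real A}" A "degree g"] fin pos A(1) by auto
    define w where "w = E div gr"
    define L where "L = E mod gr"
    have Ewl: "E = gr * w + L" by (simp add: w_def L_def)
    have "gr \<noteq> 0" using deg_gr \<open>degree g > 0\<close> by auto
    have degL: "degree L < degree g"
      using degree_mod_less[OF \<open>gr \<noteq> 0\<close>, of E] deg_gr \<open>degree g > 0\<close> by (auto simp: L_def)
    have degw: "degree w + degree g \<le> degree E"
    proof (cases "w = 0")
      case False
      then have "degree (gr * w) = degree g + degree w"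
        using \<open>gr \<noteq> 0\<close> by (simp add: degree_mult_eq deg_gr)
      then have "degree E = degree g + degree w"
        unfolding Ewl using degL by (subst degree_add_eq_left) auto
      then show ?thesis by simp
    qed (use E(1) in simp)
    have LA: "poly L A = 1" using E(3) grA by (simp add: Ewl)
    have Lz: "poly (map_poly of_real L) z = 0" if "z \<in> Z" "z \<noteq> of_real A" for z
    proof -
      have "poly (map_poly of_real E) z = poly (map_poly of_real L) z"
        unfolding Ewl map_poly_of_real_add map_poly_of_real_mult gr_of_real
        using that by (simp add: Z)
      then show ?thesis using E(4) that by simp
    qed
    have "\<forall>n. \<exists>q r. monom 1 n = g * q + r \<and> degree r < degree g"
      using monic_int_power_division[OF monic] \<open>degree g > 0\<close> by (metis degree_0)
    then obtain q r where qr: "\<And>n. monom 1 n = g * q n + r n" "\<And>n. degree (r n) < degree g"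
      by metis
    have limr: "(\<lambda>n. of_int (coeff (r n) i) / A ^ n) \<longlonglongrightarrow> coeff L i" for i
      by (rule remainder_coeff_tendsto[OF Z card fin A dom qr degL LA Lz])
    \<comment> \<open>Rounding moves each coefficient of \<open>A^n w\<close> by less than 1, which
      is negligible against \<open>A ^ n\<close> since \<open>A > 1\<close>. The multiple
      \<open>g * W n\<close> leaves the value at \<open>A\<close> unchanged.\<close>
    define W where "W n = map_poly (\<lambda>c. \<lfloor>A ^ n * c\<rfloor>) w" for n
    have cW: "coeff (W n) i = \<lfloor>A ^ n * coeff w i\<rfloor>" for n i by (simp add: W_def coeff_map_poly)
    define R where "R n = r n + g * W n" for n
    have limR: "(\<lambda>n. of_int (coeff (R n) i) / A ^ n) \<longlonglongrightarrow> coeff E i" for i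
    proof -
      have "(\<lambda>n. of_int (coeff (r n) i) / A ^ n +
          (\<Sum>j\<le>i. of_int (coeff g j) * (of_int \<lfloor>A ^ n * coeff w (i - j)\<rfloor> / A ^ n)))
        \<longlonglongrightarrow> coeff L i + (\<Sum>j\<le>i. of_int (coeff g j) * coeff w (i - j))"
        by (intro tendsto_add limr tendsto_sum tendsto_mult tendsto_const floor_scaled_tendsto 2)
      moreover have "coeff L i + (\<Sum>j\<le>i. of_int (coeff g j) * coeff w (i - j)) = coeff E i"
        by (simp add: Ewl coeff_mult gr_def coeff_map_poly)
      moreover have "of_int (coeff (r n) i) / A ^ n +
          (\<Sum>j\<le>i. of_int (coeff g j) * (of_int \<lfloor>A ^ n * coeff w (i - j)\<rfloor> / A ^ n)) =
          of_int (coeff (R n) i) / A ^ n" for n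
        by (simp add: R_def coeff_mult cW add_divide_distrib sum_divide_distrib)
      ultimately show ?thesis by simp
    qed
    \<comment> \<open>Only the indices up to \<open>degree E\<close> matter, so a single
      \<open>n\<close> serves all of them; taking \<open>n > degree E\<close> as well makes the
      relation have degree below \<open>n\<close>.\<close>
    have "\<forall>\<^sub>F n in sequentially. \<forall>i\<in>{..degree E}. of_int (coeff (R n) i) / A ^ n > 0"
      using E(2) by (intro eventually_ball_finite) (auto intro!: order_tendstoD(1)[OF limR])
    moreover have "\<forall>\<^sub>F n in sequentially. n > degree E" by (rule eventually_gt_at_top)
    ultimately have "\<forall>\<^sub>F n in sequentially.
        (\<forall>i\<in>{..degree E}. of_int (coeff (R n) i) / A ^ n > 0) \<and> n > degree E"
      by (rule eventually_conj)
    then obtain n where "\<forall>i\<in>{..degree E}. of_int (coeff (R n) i) / A ^ n > 0" and n_gt: "n > degree E"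
      using eventually_happens'[OF sequentially_bot] by blast
    then have n: "of_int (coeff (R n) i) / A ^ n > 0" if "i \<le> degree E" for i
      using that by blast
    have "degree (g * W n) \<le> degree E"
      using degree_mult_le[of g "W n"] degw map_poly_degree_leq[of "\<lambda>c. \<lfloor>A ^ n * c\<rfloor>" w]
      by (simp add: W_def)
    then have degR: "degree (R n) \<le> degree E"
      unfolding R_def using qr(2)[of n] E(1) by (intro degree_add_le) auto
    have nonneg: "coeff (R n) i \<ge> 0" for i
    proof (cases "i \<le> degree E")
      case True
      then have "of_int (coeff (R n) i) / A ^ n > 0" by (rule n)
      then show ?thesis using 2 by (simp add: zero_less_divide_iff)
    qed (use degR in \<open>simp add: coeff_eq_0\<close>)
    define f where "f = map_poly nat (R n)"
    have "map_poly real f = map_poly of_int (R n)"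
      by (rule poly_eqI) (simp add: f_def coeff_map_poly nonneg)
    moreover have "poly (map_poly of_int (R n)) A = A ^ n"
    proof -
      have "A ^ n = poly (map_poly of_int (monom 1 n)) A" by (simp add: map_poly_monom poly_monom)
      also have "\<dots> = poly (map_poly of_int (r n)) A"
        unfolding qr(1)[of n] using grA by (simp add: map_poly_of_int_add map_poly_of_int_mult gr_def)
      also have "\<dots> = poly (map_poly of_int (R n)) A"
        using grA by (simp add: R_def map_poly_of_int_add map_poly_of_int_mult gr_def)
      finally show ?thesis by simp
    qed
    moreover have "degree f < n"
      using degR n_gt map_poly_degree_leq[of nat "R n"] by (simp add: f_def)
    ultimately show ?thesis by (intro that[of f n]) simp_all
  qed
qed

section \<open>Conjugates of maximal modulus\<close>

text \<open>\<open>H\<close> below is the stabiliser of \<open>U\<close>: a finite group, hence the group of \<open>h\<close>-th roots of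
  unity, that contains all squares of elements of \<open>U\<close>. So \<open>U\<close> is \<open>H\<close> or \<open>H\<close> together with
  one further coset \<open>u H\<close> where \<open>u\<^sup>h = -1\<close>.\<close>

lemma power_card_of_reflection_closed:
  fixes U :: "complex set"
  assumes fin: "finite U" and one: "1 \<in> U" and zero: "0 \<notin> U"
    and refl: "\<And>u v. u \<in> U \<Longrightarrow> v \<in> U \<Longrightarrow> u\<^sup>2 / v \<in> U"
    and "u \<in> U"
  shows "u ^ card U = 1"
proof -
  define H where "H = {h. \<forall>v\<in>U. h * v \<in> U}"
  define h where "h = card H"
  have HU: "H \<subseteq> U" using one by (force simp: H_def)
  have finH: "finite H" using HU fin by (rule finite_subset)
  have "1 \<in> H" by (simp add: H_def)
  then have "h > 0" using finH by (auto simp: h_def card_gt_0_iff)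
  \<comment> \<open>Reflect first at 1, then at \<open>v\<close>: the element \<open>x\<close> goes
    to \<open>1 / x\<close> and on to \<open>v^2 x\<close>.\<close>
  have sq: "v\<^sup>2 \<in> H" if "v \<in> U" for v
    using refl[OF that refl[OF one]] by (simp add: H_def)
  have H_one: "v ^ h = 1" if "v \<in> H" for v
  proof -
    have "v \<noteq> 0" using that HU zero by auto
    \<comment> \<open>Multiplication by \<open>v\<close> permutes \<open>H\<close>; comparing the
      product of all elements before and after gives \<open>v ^ h = 1\<close>.\<close>
    have "(\<lambda>x. v * x) ` H = H"
    proof (rule endo_inj_surj[OF finH])
      show "(\<lambda>x. v * x) ` H \<subseteq> H" using that by (auto simp: H_def mult.assoc)
      show "inj_on (\<lambda>x. v * x) H" using \<open>v \<noteq> 0\<close> by (auto simp: inj_on_def)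
    qed
    moreover have "inj_on (\<lambda>x. v * x) H" using \<open>v \<noteq> 0\<close> by (auto simp: inj_on_def)
    ultimately have "\<Prod>H = (\<Prod>x\<in>H. v * x)"
      by (metis (no_types, lifting) prod.reindex_cong)
    also have "\<dots> = v ^ h * \<Prod>H" by (simp add: prod.distrib h_def)
    finally show ?thesis using finH HU zero by (auto simp: prod_zero_iff)
  qed
  \<comment> \<open>\<open>H\<close> consists of \<open>h\<close>-th roots of unity and already has
    \<open>h\<close> elements.\<close>
  have roots: "H = {v. v ^ h = 1}"
    using H_one \<open>h > 0\<close> card_roots_unity_eq[of h] finite_roots_unity[of h]
    by (intro card_subset_eq) (auto simp: h_def)
  have U_cases: "v \<in> H \<or> v ^ h = -1" if "v \<in> U" for v
  proof -
    have "(v ^ h)\<^sup>2 = 1" using H_one[OF sq[OF that]] by (simp add: mult.commute flip: power_mult)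
    then show ?thesis unfolding roots by (auto simp: power2_eq_1_iff)
  qed
  show ?thesis
  proof (cases "U = H")
    case True
    then show ?thesis using H_one[of u] \<open>u \<in> U\<close> by (simp add: h_def)
  next
    case False
    then obtain w where w: "w \<in> U" "w \<notin> H" using HU by blast
    then have wh: "w ^ h = -1" and "w \<noteq> 0" using U_cases zero by auto
    have "U - H = (\<lambda>x. x * w) ` H"
    proof (intro equalityI subsetI)
      fix v assume v: "v \<in> U - H"
      then have "v ^ h = -1" using U_cases by auto
      then have "v / w \<in> H" unfolding roots by (simp add: power_divide wh)
      then show "v \<in> (\<lambda>x. x * w) ` H" using \<open>w \<noteq> 0\<close> by (intro image_eqI[of _ _ "v / w"]) auto
    next
      fix v assume "v \<in> (\<lambda>x. x * w) ` H"
      then obtain x where x: "x \<in> H" "v = x * w" by blast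
      then have "v \<in> U" using w by (simp add: H_def)
      moreover have "v ^ h = -1" using x H_one by (simp add: power_mult_distrib wh)
      ultimately show "v \<in> U - H" by (simp add: roots)
    qed
    then have "card (U - H) = h"
      using \<open>w \<noteq> 0\<close> by (simp add: card_image inj_on_def h_def)
    then have "card U = 2 * h"
      using HU finH fin by (simp add: card_Diff_subset h_def)
    moreover have "u ^ h = 1 \<or> u ^ h = -1" using U_cases[OF \<open>u \<in> U\<close>] H_one by blast
    ultimately show ?thesis by (auto simp: mult.commute[of 2] power_mult)
  qed
qed

lemma poly_of_rat_cnj: "poly (map_poly of_rat p) (cnj z) = cnj (poly (map_poly of_rat p) z)"
proof (induction p)
  case (pCons a p)
  have "cnj (of_rat a) = of_rat a" by (cases a) (simp add: of_rat_rat)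
  with pCons show ?case by (simp add: map_poly_pCons)
qed simp

context
  fixes m :: "rat poly" and \<alpha> :: real and Z :: "complex set"
  assumes irr: "irreducible m" and monic: "lead_coeff m = 1"
    and Z: "Z = {z. poly (map_poly of_rat m) z = 0}"
    and \<alpha>: "\<alpha> > 0" "of_real \<alpha> \<in> Z" and max: "\<And>z. z \<in> Z \<Longrightarrow> norm z \<le> \<alpha>"
begin

lemma finite_conjugates: "finite Z"
  using irr unfolding Z by (intro poly_roots_finite) (auto simp: map_poly_eq_0_iff)

text \<open>Otherwise \<open>m\<close> would divide \<open>X\<close>, and its root \<alpha> would be
  0.\<close>

lemma zero_not_conjugate: "0 \<notin> Z"
proof
  assume "0 \<in> Z"
  then have "m dvd [:0, 1:]"
    using irreducible_dvd_of_common_root[OF irr, of "0::complex" "[:0, 1:]"] by (simp add: Z map_poly_pCons)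
  then obtain q where "[:0, 1:] = m * q" by blast
  then have "poly (map_poly of_rat [:0, 1:]) (complex_of_real \<alpha>) = 0"
    using \<alpha>(2) by (simp only: map_poly_of_rat_mult) (simp add: Z)
  with \<alpha>(1) show False by (simp add: map_poly_pCons)
qed

lemma prod_conjugates: "(\<Prod>z\<in>Z. [:- z, 1:]) = map_poly of_rat m"
proof -
  have "lead_coeff (map_poly of_rat m :: complex poly) = 1"
    using monic by (simp add: degree_map_poly coeff_map_poly)
  with complex_poly_decompose_rsquarefree[OF rsquarefree_irreducible[OF irr]] show ?thesis
    by (simp add: Z)
qed

lemma card_conjugates: "card Z = degree m"
proof -
  have "degree (\<Prod>z\<in>Z. [:- z, 1:]) = card Z" by (simp add: degree_prod_eq_sum_degree)
  then show ?thesis unfolding prod_conjugates by (simp add: degree_map_poly)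
qed

lemma Rats_power_sum_conjugates: "(\<Sum>z\<in>Z. z ^ n) \<in> \<rat>"
proof (rule Rats_power_sum_of_coeff)
  show "coeff (\<Prod>z\<in>Z. [:- z, 1:]) n \<in> \<rat>" for n
    unfolding prod_conjugates by (simp add: coeff_map_poly)
qed (use finite_conjugates zero_not_conjugate in auto)

text \<open>Ordered pairs of conjugates with product \<open>x^2\<close> are equally many for
  \<open>x = \<alpha>\<close> and \<open>x = b\<close>. At \<alpha> they are the pairs
  \<open>(x, cnj x)\<close>, one for each conjugate of maximal modulus. At \<open>b\<close> such an
  \<open>x\<close> admits at most the partner \<open>b^2 / x\<close>, so equality of the counts
  makes every partner a conjugate.\<close>

lemma reflection_conjugate:
  assumes b: "b \<in> Z" "norm b = \<alpha>" and c: "c \<in> Z" "norm c = \<alpha>"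
  shows "b\<^sup>2 / c \<in> Z"
proof -
  define C where "C = {z\<in>Z. norm z = \<alpha>}"
  define P where "P x = {p\<in>Z \<times> Z. fst p * snd p = x\<^sup>2}" for x :: complex
  have finC: "finite C" using finite_conjugates by (simp add: C_def)
  have "b \<noteq> 0" using b \<alpha> by auto
  \<comment> \<open>The product has modulus \<open>\<alpha>^2\<close> while neither factor exceeds
    \<alpha>, so \<open>x\<close> must have modulus \<alpha>.\<close>
  have max_factor: "x \<in> C" if "x \<in> Z" "y \<in> Z" "x * y = t\<^sup>2" "norm t = \<alpha>" for x y t
  proof -
    have "norm x * norm y = \<alpha>\<^sup>2" using that by (metis norm_mult norm_power)
    moreover have "norm x * norm y \<le> norm x * \<alpha>" using max[OF that(2)] by (intro mult_left_mono) auto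
    ultimately have "\<alpha> \<le> norm x" using \<alpha>(1) by (simp add: power2_eq_square)
    with max[OF that(1)] that(1) show ?thesis by (simp add: C_def)
  qed
  \<comment> \<open>The fibre count applies to the products over \<open>Z \<times> Z\<close> with
    exponent 2: their power sums are squares of those of \<open>Z\<close>, hence rational.\<close>
  have "card (P (of_real \<alpha>)) = card (P b)"
    unfolding P_def
  proof (rule card_fibre_conjugate[of _ "\<lambda>p. fst p * snd p" m])
    show "(\<Sum>p\<in>Z \<times> Z. (fst p * snd p) ^ n) \<in> \<rat>" for n
    proof -
      have "(\<Sum>p\<in>Z \<times> Z. (fst p * snd p) ^ n) = (\<Sum>x\<in>Z. x ^ n) * (\<Sum>y\<in>Z. y ^ n)"
        by (simp add: sum_product sum.cartesian_product power_mult_distrib case_prod_unfold)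
      then show ?thesis using Rats_power_sum_conjugates by simp
    qed
  qed (use irr \<alpha> b \<open>b \<noteq> 0\<close> finite_conjugates zero_not_conjugate in \<open>auto simp: Z\<close>)
  moreover have "P (of_real \<alpha>) = (\<lambda>x. (x, cnj x)) ` C"
  proof (intro equalityI subsetI)
    fix p assume "p \<in> P (of_real \<alpha>)"
    then obtain x y where p: "p = (x, y)" "x \<in> Z" "y \<in> Z" "x * y = (of_real \<alpha>)\<^sup>2"
      by (auto simp: P_def)
    then have "x \<in> C" using \<alpha>(1) by (intro max_factor[of x y "of_real \<alpha>"]) auto
    then have "x * cnj x = (of_real \<alpha>)\<^sup>2" by (simp add: C_def flip: complex_norm_square)
    then have "x * y = x * cnj x" using p(4) by simp
    then have "y = cnj x" using \<open>x \<in> Z\<close> zero_not_conjugate by auto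
    with p(1) \<open>x \<in> C\<close> show "p \<in> (\<lambda>x. (x, cnj x)) ` C" by blast
  next
    fix p assume "p \<in> (\<lambda>x. (x, cnj x)) ` C"
    then obtain x where "p = (x, cnj x)" "x \<in> C" by blast
    then show "p \<in> P (of_real \<alpha>)"
      by (simp add: P_def C_def Z poly_of_rat_cnj flip: complex_norm_square)
  qed
  then have "card (P (of_real \<alpha>)) = card C" by (simp add: card_image inj_on_def)
  moreover have "P b \<subseteq> (\<lambda>x. (x, b\<^sup>2 / x)) ` C"
  proof
    fix p assume "p \<in> P b"
    then obtain x y where p: "p = (x, y)" "x \<in> Z" "y \<in> Z" "x * y = b\<^sup>2"
      by (auto simp: P_def)
    then have "x \<in> C" "x \<noteq> 0" using b zero_not_conjugate by (auto intro: max_factor[of x y b])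
    with p show "p \<in> (\<lambda>x. (x, b\<^sup>2 / x)) ` C" by (intro image_eqI[of _ _ x]) (auto simp: field_simps)
  qed
  ultimately have "P b = (\<lambda>x. (x, b\<^sup>2 / x)) ` C"
    using finC by (intro card_subset_eq) (auto simp: card_image inj_on_def)
  then have "(c, b\<^sup>2 / c) \<in> P b" using c by (auto simp: C_def)
  then show ?thesis by (simp add: P_def)
qed

text \<open>Divided by \<alpha>, the conjugates of maximal modulus are closed under reflection, so
  with \<open>k\<close> their number they are exactly the \<open>k\<close>-th roots of unity. Thus
  the fibre of \<open>y \<mapsto> y^k\<close> on \<open>Z\<close> through \<alpha> has
  \<open>k\<close> elements. By the fibre count so does the one through any conjugate
  \<open>z\<close>, which therefore contains all \<open>k\<close>-th roots of
  \<open>z^k\<close>.\<close>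

lemma maximal_conjugates:
  obtains k where "k > 0" "{z\<in>Z. norm z = \<alpha>} = {z. z ^ k = of_real \<alpha> ^ k}"
    "\<And>y z. z \<in> Z \<Longrightarrow> y ^ k = z ^ k \<Longrightarrow> y \<in> Z"
proof -
  define C where "C = {z\<in>Z. norm z = \<alpha>}"
  define k where "k = card C"
  have finC: "finite C" using finite_conjugates by (simp add: C_def)
  have "of_real \<alpha> \<in> C" using \<alpha> by (simp add: C_def)
  then have "k > 0" using finC by (auto simp: k_def card_gt_0_iff)
  define U where "U = (\<lambda>z. z / of_real \<alpha>) ` C"
  have "inj_on (\<lambda>z. z / of_real \<alpha>) C" using \<alpha>(1) by (auto simp: inj_on_def)
  then have cardU: "card U = k" by (simp add: U_def k_def card_image)
  have Ck: "z ^ k = of_real \<alpha> ^ k" if "z \<in> C" for z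
  proof -
    have "(z / of_real \<alpha>) ^ card U = 1"
    proof (rule power_card_of_reflection_closed)
      show "finite U" using finC by (simp add: U_def)
      show "1 \<in> U" using \<open>of_real \<alpha> \<in> C\<close> \<alpha>(1) by (force simp: U_def)
      show "0 \<notin> U" using zero_not_conjugate \<alpha>(1) by (auto simp: U_def C_def)
      show "z / of_real \<alpha> \<in> U" using that by (auto simp: U_def)
      fix u v assume "u \<in> U" "v \<in> U"
      then obtain b c where bc: "b \<in> C" "c \<in> C" "u = b / of_real \<alpha>" "v = c / of_real \<alpha>"
        by (auto simp: U_def)
      have "b\<^sup>2 / c \<in> C"
        using reflection_conjugate[of b c] bc \<alpha>(1)
        by (simp add: C_def norm_divide norm_mult power2_eq_square)
      moreover have "u\<^sup>2 / v = (b\<^sup>2 / c) / of_real \<alpha>"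
        using \<alpha>(1) by (simp add: bc power2_eq_square)
      ultimately show "u\<^sup>2 / v \<in> U" unfolding U_def by (intro image_eqI)
    qed
    then show ?thesis using \<alpha>(1) by (simp add: cardU power_divide)
  qed
  have fibre: "card {y :: complex. y ^ k = z ^ k} = k" "finite {y :: complex. y ^ k = z ^ k}" if "z \<noteq> 0" for z
  proof -
    show *: "card {y :: complex. y ^ k = z ^ k} = k" using that \<open>k > 0\<close> by (intro card_nth_roots) auto
    show "finite {y :: complex. y ^ k = z ^ k}" using * \<open>k > 0\<close> by (metis card_gt_0_iff)
  qed
  have C: "C = {z. z ^ k = of_real \<alpha> ^ k}"
    using fibre[of "of_real \<alpha>"] \<alpha>(1) Ck by (intro card_subset_eq) (auto simp: k_def[symmetric])
  have closed: "y \<in> Z" if z: "z \<in> Z" and y: "y ^ k = z ^ k" for y z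
  proof -
    have "z \<noteq> 0" using z zero_not_conjugate by auto
    have "card {y\<in>Z. y ^ k = (of_real \<alpha>) ^ k} = card {y\<in>Z. y ^ k = z ^ k}"
    proof (rule card_fibre_conjugate[of _ "\<lambda>y. y ^ k" m])
      show "(\<Sum>y\<in>Z. (y ^ k) ^ n) \<in> \<rat>" for n
        using Rats_power_sum_conjugates[of "k * n"] by (simp add: power_mult)
    qed (use irr \<alpha> z \<open>z \<noteq> 0\<close> \<open>k > 0\<close> finite_conjugates zero_not_conjugate in \<open>auto simp: Z\<close>)
    moreover have "{y\<in>Z. y ^ k = (of_real \<alpha>) ^ k} = C" using C by (auto simp: C_def)
    ultimately have "{y\<in>Z. y ^ k = z ^ k} = {y. y ^ k = z ^ k}"
      using fibre[OF \<open>z \<noteq> 0\<close>] by (intro card_subset_eq) (auto simp: k_def)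
    with y show ?thesis by blast
  qed
  show ?thesis using \<open>k > 0\<close> C closed unfolding C_def by (rule that)
qed

end

section \<open>Reduction to a strictly dominant root\<close>

lemma pcompose_monom_altdef:
  "pcompose (\<Sum>j\<le>d. monom (c j) j) (monom 1 k) = (\<Sum>j\<le>d. monom (c j :: 'a::comm_ring_1) (k * j))"
proof -
  have "pcompose (monom a j) (monom 1 k) = monom a (k * j)" for a :: 'a and j
  proof -
    have "pcompose (monom a j) q = smult a (q ^ j)" for q
      by (induction j) (simp_all add: monom_0 monom_Suc pcompose_pCons)
    then show ?thesis by (simp add: monom_power smult_monom)
  qed
  then show ?thesis by (simp add: pcompose_sum)
qed

text \<open>If the root set is invariant under the rotations by \<open>k\<close>-th roots of unity, comparing the
  coefficients of \<open>p(\<zeta>X)\<close> and \<open>\<zeta>\<^sup>d p(X)\<close> leaves only exponents divisible by \<open>k\<close>.\<close>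

lemma int_poly_in_power:
  fixes p :: "int poly" and Z :: "complex set"
  assumes monic: "lead_coeff p = 1"
    and Z: "Z = {z. poly (map_poly of_int p) z = 0}" and card: "card Z = degree p"
    and "0 \<notin> Z" and "k > 0" and closed: "\<And>y z. z \<in> Z \<Longrightarrow> y ^ k = z ^ k \<Longrightarrow> y \<in> Z"
  obtains g :: "int poly" where "p = pcompose g (monom 1 k)"
proof -
  define P where "P = map_poly complex_of_int p"
  have cP: "coeff P i = of_int (coeff p i)" for i by (simp add: P_def coeff_map_poly)
  have degP: "degree P = degree p" by (simp add: P_def degree_map_poly)
  have p0: "coeff p 0 \<noteq> 0"
    using \<open>0 \<notin> Z\<close> by (simp add: Z poly_0_coeff_0 coeff_map_poly)
  have rot: "coeff p i = 0 \<or> \<zeta> ^ i = 1" if \<zeta>: "\<zeta> ^ k = 1" for i and \<zeta> :: complex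
  proof -
    \<comment> \<open>Both sides have degree at most \<open>card Z\<close>, the same top
      coefficient, and vanish on the rotation-invariant set \<open>Z\<close>.\<close>
    have "pcompose P [:0, \<zeta>:] = smult (\<zeta> ^ degree p) P"
    proof (rule poly_eqI_degree_lead_coeff[of _ "degree p" _ Z])
      show "coeff (pcompose P [:0, \<zeta>:]) (degree p) = coeff (smult (\<zeta> ^ degree p) P) (degree p)"
        by (simp add: coeff_pcompose_linear)
      show "degree (pcompose P [:0, \<zeta>:]) \<le> degree p"
        using degree_pcompose_le[of P "[:0, \<zeta>:]"] by (simp add: degP split: if_splits)
      show "degree (smult (\<zeta> ^ degree p) P) \<le> degree p"
        using degree_smult_le[of _ P] by (simp add: degP)
      show "poly (pcompose P [:0, \<zeta>:]) z = poly (smult (\<zeta> ^ degree p) P) z" if "z \<in> Z" for z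
      proof -
        have "\<zeta> * z \<in> Z" using closed[OF that, of "\<zeta> * z"] \<zeta> by (simp add: power_mult_distrib)
        with that show ?thesis by (simp add: Z P_def poly_pcompose mult.commute)
      qed
    qed (simp add: card)
    then have eq: "\<zeta> ^ j * of_int (coeff p j) = \<zeta> ^ degree p * of_int (coeff p j)" for j
      by (metis coeff_pcompose_linear coeff_smult cP)
    from eq[of 0] p0 have "\<zeta> ^ degree p = 1" by simp
    with eq[of i] show ?thesis by auto
  qed
  have supp: "k dvd i" if "coeff p i \<noteq> 0" for i
  proof (rule ccontr)
    assume "\<not> k dvd i"
    then have r: "i mod k > 0" "i mod k < k" using \<open>k > 0\<close> by (auto simp: dvd_eq_mod_eq_0)
    \<comment> \<open>If \<zeta>^i = 1 for all \<open>k\<close>-th roots of unity, then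
      \<open>X^(i mod k) - 1\<close> has \<open>k\<close> roots, more than its degree.\<close>
    have "\<zeta> ^ (i mod k) = 1" if "\<zeta> ^ k = 1" for \<zeta> :: complex
    proof -
      have "\<zeta> ^ i = (\<zeta> ^ k) ^ (i div k) * \<zeta> ^ (i mod k)"
        by (simp flip: power_mult power_add)
      then show ?thesis using rot[OF that, of i] \<open>coeff p i \<noteq> 0\<close> that by simp
    qed
    then have "card {\<zeta> :: complex. \<zeta> ^ k = 1} \<le> card {\<zeta> :: complex. \<zeta> ^ (i mod k) = 1}"
      using r by (intro card_mono finite_roots_unity) auto
    then show False using r \<open>k > 0\<close> by (simp add: card_roots_unity_eq)
  qed
  \<comment> \<open>Terms with \<open>k * j\<close> beyond the degree vanish, so the upper limit
    need not be divided by \<open>k\<close>.\<close>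
  have "p = (\<Sum>j\<le>degree p. monom (coeff p (k * j)) (k * j))"
  proof (rule poly_eqI)
    fix i
    have "coeff (\<Sum>j\<le>degree p. monom (coeff p (k * j)) (k * j)) i =
        (\<Sum>j\<le>degree p. if k * j = i then coeff p i else 0)"
      by (simp add: coeff_sum cong: if_cong)
    also have "\<dots> = coeff p i"
    proof (cases "coeff p i = 0")
      case False
      then obtain j where j: "i = k * j" using supp by blast
      have "j \<le> degree p"
        using le_degree[OF False] \<open>k > 0\<close> j by (metis le_trans mult_le_mono1 nat_mult_1 Suc_leI One_nat_def)
      moreover have "k * j' = i \<longleftrightarrow> j' = j" for j' using j \<open>k > 0\<close> by auto
      ultimately show ?thesis by simp
    qed (auto intro!: sum.neutral)
    finally show "coeff p i = coeff (\<Sum>j\<le>degree p. monom (coeff p (k * j)) (k * j)) i" by simp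
  qed
  then have "p = pcompose (\<Sum>j\<le>degree p. monom (coeff p (k * j)) j) (monom 1 k)"
    by (simp only: pcompose_monom_altdef)
  then show ?thesis by (rule that)
qed

section \<open>Substitution of \<open>X^k\<close> and the sufficiency of the weak Perron
  condition\<close>

lemma poly_of_nat_pcompose_monom:
  fixes f :: "nat poly"
  shows "poly (map_poly of_nat (pcompose f (monom 1 k))) (x :: 'a::comm_semiring_1) = poly (map_poly of_nat f) (x ^ k)"
proof (induction f)
  case (pCons a f)
  have "map_poly of_nat (p + q) = (map_poly of_nat p + map_poly of_nat q :: 'a poly)"
    "map_poly of_nat (p * q) = (map_poly of_nat p * map_poly of_nat q :: 'a poly)" for p q :: "nat poly"
    by (rule poly_eqI; simp add: coeff_map_poly coeff_mult)+
  with pCons show ?case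
    by (simp add: pcompose_pCons map_poly_pCons map_poly_monom poly_monom)
qed simp

lemma poly_of_int_pcompose_monom:
  "poly (map_poly of_int (pcompose f (monom 1 k))) (x :: 'a::comm_ring_1) = poly (map_poly of_int f) (x ^ k)"
proof (induction f)
  case (pCons a f)
  then show ?case
    by (simp add: pcompose_pCons map_poly_pCons map_poly_monom poly_monom
        map_poly_of_int_add map_poly_of_int_mult)
qed simp

text \<open>Passing to \<open>\<alpha>^k\<close> merges all conjugates of maximal modulus into one
  strictly dominant root of \<open>g\<close>. A power relation for \<open>\<alpha>^k\<close> becomes
  one for \<alpha> on substituting \<open>X^k\<close>.\<close>

lemma weak_perron_imp_fin_gen:
  fixes \<alpha> :: real
  assumes int: "algebraic_int \<alpha>" and wp: "weak_perron \<alpha>"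
    and uniq: "\<And>\<beta>::real. \<beta> > 0 \<Longrightarrow> poly (map_poly of_rat (min_poly \<alpha>)) \<beta> = 0 \<Longrightarrow> \<beta> = \<alpha>"
  shows "fin_gen_monoid (nat_poly_monoid \<alpha>)"
proof -
  define m where "m = min_poly \<alpha>"
  define Z where "Z = {z :: complex. poly (map_poly of_rat m) z = 0}"
  have "is_min_poly \<alpha> m" unfolding m_def using int by (intro is_min_poly_min_poly) auto
  then have irr: "irreducible m" and monic: "lead_coeff m = 1" and root: "poly (map_poly of_rat m) \<alpha> = 0"
    by (auto simp: is_min_poly_def)
  have max: "norm z \<le> \<alpha>" if "z \<in> Z" for z
    using wp that by (auto simp: weak_perron_def galois_conjugate_def Z_def m_def)
  have \<alpha>: "\<alpha> > 0" using wp by (simp add: weak_perron_def)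
  have \<alpha>Z: "of_real \<alpha> \<in> Z" using root by (simp add: Z_def poly_of_rat_of_real)
  note ctxt = irr monic Z_def \<alpha> \<alpha>Z max
  have zero: "0 \<notin> Z" by (rule zero_not_conjugate[OF ctxt])
  obtain mi :: "int poly" where mi: "m = map_poly of_int mi"
    using min_poly_integral[OF int] unfolding m_def by blast
  have m_mi: "map_poly of_rat m = (map_poly of_int mi :: complex poly)"
    by (rule poly_eqI) (simp add: mi coeff_map_poly)
  have deg_mi: "degree m = degree mi" by (simp add: mi degree_map_poly)
  have monic_mi: "lead_coeff mi = 1"
    using monic unfolding deg_mi by (simp add: mi coeff_map_poly)
  have cardZ: "card Z = degree mi" using card_conjugates[OF ctxt] deg_mi by simp
  have Zmi: "Z = {z. poly (map_poly of_int mi) z = 0}" by (simp add: Z_def m_mi)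
  obtain k where k: "k > 0" "{z\<in>Z. norm z = \<alpha>} = {z. z ^ k = of_real \<alpha> ^ k}"
      "\<And>y z. z \<in> Z \<Longrightarrow> y ^ k = z ^ k \<Longrightarrow> y \<in> Z"
    using maximal_conjugates[OF ctxt] by blast
  have "\<exists>g. mi = pcompose g (monom 1 k)"
    by (rule int_poly_in_power[OF monic_mi Zmi cardZ zero k(1)]) (use k(3) in blast)+
  then obtain g where g: "mi = pcompose g (monom 1 k)" by blast
  define W where "W = {w :: complex. poly (map_poly of_int g) w = 0}"
  have WZ: "z ^ k \<in> W \<longleftrightarrow> z \<in> Z" for z
    by (simp add: W_def Zmi g poly_of_int_pcompose_monom)
  have zeroW: "0 \<notin> W" using WZ[of 0] zero k(1) by (simp add: zero_power)
  have root_ex: "\<exists>z\<in>Z. z ^ k = w" if "w \<in> W" for w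
  proof -
    have "w \<noteq> 0" using zeroW that by auto
    then have "card {z. z ^ k = w} \<noteq> 0" using k(1) by (simp add: card_nth_roots)
    then obtain z where "z ^ k = w" by (metis (mono_tags, lifting) card.empty empty_Collect_eq)
    with WZ[of z] that show ?thesis by auto
  qed
  have deg_g: "degree mi = degree g * k"
    by (simp add: g degree_pcompose degree_monom_eq)
  have monic_g: "lead_coeff g = 1"
    using monic_mi k(1) unfolding g by (subst (asm) lead_coeff_comp) (auto simp: degree_monom_eq)
  have finW: "finite W"
    unfolding W_def using monic_g by (intro poly_roots_finite) (auto simp: map_poly_eq_0_iff)
  \<comment> \<open>\<open>g\<close> has only simple roots: the \<open>degree g * k\<close>
    conjugates are spread over the roots of \<open>g\<close>, with at most \<open>k\<close> above
    each.\<close>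
  have cardW: "card W = degree g"
  proof (rule antisym)
    have "card Z \<le> card (\<Union>w\<in>W. {z. z ^ k = w})"
      using finW WZ k(1) by (intro card_mono finite_UN_I) (auto intro: finite_nth_roots)
    also have "\<dots> \<le> (\<Sum>w\<in>W. card {z. z ^ k = w})" by (rule card_UN_le[OF finW])
    also have "\<dots> = (\<Sum>w\<in>W. k)"
      using zeroW k(1) by (intro sum.cong refl card_nth_roots) auto
    finally have "degree g * k \<le> card W * k" using cardZ deg_g by simp
    then show "degree g \<le> card W" using k(1) by simp
    show "card W \<le> degree g"
      unfolding W_def using monic_g card_poly_roots_bound[of "map_poly of_int g :: complex poly"]
      by (fastforce simp: degree_map_poly map_poly_eq_0_iff)
  qed
  obtain n and f :: "nat poly" where nf: "degree f < n" "(\<alpha> ^ k) ^ n = poly (map_poly real f) (\<alpha> ^ k)"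
  proof (rule strictly_dominant_power_relation[OF monic_g W_def cardW, of "\<alpha> ^ k"])
    show "\<alpha> ^ k > 0" using \<alpha> by simp
    show "of_real (\<alpha> ^ k) \<in> W" using WZ[of "of_real \<alpha>"] \<alpha>Z by simp
    show "norm w < \<alpha> ^ k" if w: "w \<in> W" "w \<noteq> of_real (\<alpha> ^ k)" for w
    proof -
      obtain z where z: "z \<in> Z" "z ^ k = w" using root_ex[OF w(1)] by blast
      have "norm z \<noteq> \<alpha>" using k(2) z w(2) by auto
      with max[OF z(1)] have "norm z < \<alpha>" by simp
      then have "norm z ^ k < \<alpha> ^ k" using k(1) by (intro power_strict_mono) auto
      then show ?thesis by (simp add: norm_power flip: z(2))
    qed
    \<comment> \<open>The nonnegative real \<open>k\<close>-th root of \<open>w\<close> is itself a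
      conjugate and is nonzero, so \<open>uniq\<close> identifies it with \<alpha>.\<close>
    show "w = of_real (\<alpha> ^ k)" if w: "w \<in> W" "Im w = 0" "Re w \<ge> 0" for w
    proof -
      define x where "x = root k (Re w)"
      have x: "x \<ge> 0" "x ^ k = Re w" using w(3) k(1) by (simp_all add: x_def)
      then have wx: "w = of_real x ^ k" using w(2) by (simp add: complex_eq_iff flip: of_real_power)
      then have xZ: "of_real x \<in> Z" using WZ[of "of_real x"] w(1) by simp
      then have "x \<noteq> 0" using zero by auto
      with x(1) xZ have "x = \<alpha>"
        by (intro uniq) (auto simp: Z_def m_def poly_of_rat_of_real)
      with wx show ?thesis by simp
    qed
  qed blast
  have "\<alpha> ^ (k * n) = poly (map_poly real (pcompose f (monom 1 k))) \<alpha>"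
    using nf(2) unfolding poly_of_nat_pcompose_monom power_mult .
  moreover have "degree (pcompose f (monom 1 k)) < k * n"
  proof -
    have "degree (pcompose f (monom 1 k)) \<le> degree f * k"
      using degree_pcompose_le[of f "monom 1 k"] by (simp add: degree_monom_eq)
    also have "\<dots> < k * n" using nf(1) k(1) by simp
    finally show ?thesis .
  qed
  ultimately show ?thesis by (rule fin_gen_of_power_relation)
qed

theorem theorem11:
  fixes \<alpha> :: real
  assumes "\<alpha> > 0" and "algebraic \<alpha>"
  shows "(fin_gen_monoid (nat_poly_monoid \<alpha>) \<longrightarrow> weak_perron \<alpha>) \<and>
         (algebraic_int \<alpha> \<and> weak_perron \<alpha> \<and>
            (\<forall>\<beta>::real. \<beta> > 0 \<and> poly (map_poly of_rat (min_poly \<alpha>)) \<beta> = 0 \<longrightarrow> \<beta> = \<alpha>)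
          \<longrightarrow> fin_gen_monoid (nat_poly_monoid \<alpha>))"
  using fin_gen_imp_weak_perron[OF assms] weak_perron_imp_fin_gen[of \<alpha>] by blast

end
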